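(* Let $\varphi\in L^\infty$, let $\alpha,\theta$ be inner functions, and let $$A=\begin{bmatrix}\varphi\theta & -1\\ \varphi\theta\bar\alpha & 0\end{bmatrix},\qquad B=\begin{bmatrix}\varphi & 0\\ \bar\alpha\varphi & -1\end{bmatrix}.$$ Then the asymmetric dual truncated Toeplitz operator $D_\varphi^{\theta,\alpha}\colon (K_\theta)^\perp\to (K_\alpha)^\perp$ is equivalent after extension to the paired operator $AP^++BP^-\colon L^2\oplus L^2\to L^2\oplus L^2$.
   Context: $L^2=L^2(\mathbb T)$, $L^\infty=L^\infty(\mathbb T)$, $\mathbb T$ the unit circle; $H^2$ is the Hardy space of the unit disk viewed as a subspace of $L^2$, and $H^2_-=\bar z\,\overline{H^2}=L^2\ominus H^2$. $P^+$ and $P^-=I-P^+$ are the orthogonal projections of $L^2$ onto $H^2$ and $H^2_-$; they act componentwise on $L^2\oplus L^2$. A matrix $M\in (L^\infty)^{2\times 2}$ is identified with the operator of multiplication by $M$ on $L^2\oplus L^2$. For an inner function $\theta$, $K_\theta=H^2\ominus\theta H^2$, $(K_\theta)^\perp=L^2\ominus K_\theta=H^2_-\oplus\theta H^2$, and $P_\theta$, $Q_\theta=I-P_\theta$ are the orthogonal projections of $L^2$ onto $K_\theta$ and $(K_\theta)^\perp$. For $\varphi\in L^\infty$ and inner $\alpha,\theta$, $D_\varphi^{\theta,\alpha}\colon (K_\theta)^\perp\to(K_\alpha)^\perp$ is defined by $D_\varphi^{\theta,\alpha}f=Q_\alpha(\varphi f)=P^-(\varphi f)+\alpha P^+(\bar\alpha\varphi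 f)$. Bounded operators $T\colon X\to\tilde X$ and $S\colon Y\to\tilde Y$ between Banach spaces are equivalent after extension if there exist (possibly trivial) Banach spaces $X_0,Y_0$ and invertible bounded operators $E\colon\tilde Y\oplus Y_0\to\tilde X\oplus X_0$, $F\colon X\oplus X_0\to Y\oplus Y_0$ such that $\begin{bmatrix}T&0\\0&I_{X_0}\end{bmatrix}=E\begin{bmatrix}S&0\\0&I_{Y_0}\end{bmatrix}F$. *)

theory Defs
  imports "HOL-Analysis.Analysis"
begin

section \<open>The unit circle with normalized arc length\<close>

definition circle :: "complex measure" where
  "circle = distr (uniform_measure lborel {0..2*pi}) (restrict_space borel (sphere 0 1)) cis"

lemma measurable_cis_circle:
  "cis \<in> uniform_measure lborel {0..2*pi} \<rightarrow>\<^sub>M restrict_space borel (sphere 0 1)"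
proof (rule measurable_restrict_space2)
  have "cis \<in> borel_measurable borel"
    by (intro borel_measurable_continuous_onI continuous_intros)
  then show "cis \<in> uniform_measure lborel {0..2*pi} \<rightarrow>\<^sub>M borel"
    by simp
qed auto

lemma space_circle: "space circle = sphere 0 1"
  by (simp add: circle_def space_restrict_space)

lemma finite_measure_circle: "finite_measure circle"
proof -
  have "emeasure (uniform_measure lborel {0..2*pi}) (space (uniform_measure lborel {0..2*pi})) \<noteq> \<infinity>"
    by (auto simp: emeasure_uniform_measure_1)
  then have "finite_measure (uniform_measure lborel {0..2*pi})"
    by (rule finite_measureI)
  then show ?thesis
    unfolding circle_def by (rule finite_measure.finite_measure_distr) (rule measurable_cis_circle)
qed

lemma emeasure_circle: "emeasure circle (space circle) = 1"
proof -
  have 1: "cis -` sphere 0 1 = (UNIV :: real set)" by auto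
  have 2: "sphere 0 1 \<in> sets (restrict_space borel (sphere (0::complex) 1))"
    by (auto simp: sets_restrict_space)
  show ?thesis
    unfolding space_circle unfolding circle_def
    by (subst emeasure_distr[OF measurable_cis_circle 2])
      (use emeasure_uniform_measure_1[of lborel "{0..2*pi}"] in \<open>simp add: 1\<close>)
qed

lemma borel_measurable_circle: "f \<in> borel_measurable borel \<Longrightarrow> f \<in> borel_measurable circle"
  unfolding circle_def by (simp add: measurable_restrict_space1)

section \<open>The Hilbert space L2 of the circle\<close>

definition square_int :: "(complex \<Rightarrow> complex) \<Rightarrow> bool" where
  "square_int f \<longleftrightarrow> f \<in> borel_measurable circle \<and> integrable circle (\<lambda>z. (cmod (f z))\<^sup>2)"

lemma square_int_measurable [measurable_dest]: "square_int f \<Longrightarrow> f \<in> borel_measurable circle"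
  by (simp add: square_int_def)

definition L2_rel :: "(complex \<Rightarrow> complex) \<Rightarrow> (complex \<Rightarrow> complex) \<Rightarrow> bool" where
  "L2_rel f g \<longleftrightarrow> square_int f \<and> square_int g \<and> (AE z in circle. f z = g z)"

lemma square_int_0: "square_int (\<lambda>z. 0)"
  by (simp add: square_int_def)

quotient_type L2 = "complex \<Rightarrow> complex" / partial: L2_rel
proof (rule part_equivpI)
  show "\<exists>f. L2_rel f f"
    by (rule exI[of _ "\<lambda>z. 0"]) (simp add: L2_rel_def square_int_0)
  show "symp L2_rel"
    by (rule sympI) (auto simp: L2_rel_def elim: AE_mp)
  show "transp L2_rel"
    by (rule transpI) (auto simp: L2_rel_def elim: AE_mp)
qed

lemma square_int_add:
  assumes "square_int f" "square_int g" shows "square_int (\<lambda>z. f z + g z)"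
proof -
  note [measurable] = assms[THEN square_int_measurable]
  have "integrable circle (\<lambda>z. (cmod (f z + g z))\<^sup>2)"
  proof (rule Bochner_Integration.integrable_bound)
    show "integrable circle (\<lambda>z. 2 * (cmod (f z))\<^sup>2 + 2 * (cmod (g z))\<^sup>2)"
      using assms by (auto simp: square_int_def)
    have "(cmod (f z + g z))\<^sup>2 \<le> 2 * (cmod (f z))\<^sup>2 + 2 * (cmod (g z))\<^sup>2" for z
    proof -
      have "(cmod (f z + g z))\<^sup>2 \<le> (cmod (f z) + cmod (g z))\<^sup>2"
        by (intro power_mono norm_triangle_ineq) auto
      also have "\<dots> \<le> 2 * (cmod (f z))\<^sup>2 + 2 * (cmod (g z))\<^sup>2"
        using sum_squares_bound[of "cmod (f z)" "cmod (g z)"] by (simp add: power2_sum)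
      finally show ?thesis .
    qed
    then show "AE z in circle. norm ((cmod (f z + g z))\<^sup>2)
        \<le> norm (2 * (cmod (f z))\<^sup>2 + 2 * (cmod (g z))\<^sup>2)"
      by simp
  qed measurable
  then show ?thesis
    by (simp add: square_int_def)
qed

lemma square_int_scale: "square_int f \<Longrightarrow> square_int (\<lambda>z. c * f z)"
  by (auto simp: square_int_def norm_mult power_mult_distrib)

lemma square_int_uminus: "square_int f \<Longrightarrow> square_int (\<lambda>z. - f z)"
  using square_int_scale[of f "-1"] by simp

lemma square_int_diff: "square_int f \<Longrightarrow> square_int g \<Longrightarrow> square_int (\<lambda>z. f z - g z)"
  using square_int_add[of f "\<lambda>z. - g z"] square_int_uminus[of g] by simp

lemma square_int_mult_integrable:
  assumes "square_int f" "square_int g"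
  shows "integrable circle (\<lambda>z. f z * cnj (g z))"
proof (rule Bochner_Integration.integrable_bound)
  note [measurable] = assms[THEN square_int_measurable]
  show "integrable circle (\<lambda>z. (cmod (f z))\<^sup>2 + (cmod (g z))\<^sup>2)"
    using assms by (auto simp: square_int_def)
  have "cmod (f z * cnj (g z)) \<le> (cmod (f z))\<^sup>2 + (cmod (g z))\<^sup>2" for z
    using sum_squares_bound[of "cmod (f z)" "cmod (g z)"]
      mult_nonneg_nonneg[of "cmod (f z)" "cmod (g z)"]
    by (simp add: norm_mult del: mult_nonneg_nonneg)
  then show "AE z in circle. norm (f z * cnj (g z)) \<le> norm ((cmod (f z))\<^sup>2 + (cmod (g z))\<^sup>2)"
    by simp
  show "(\<lambda>z. f z * cnj (g z)) \<in> borel_measurable circle"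
    using borel_measurable_continuous_onI[OF continuous_on_cnj[OF continuous_on_id]]
    by (auto intro!: borel_measurable_times measurable_compose[of g circle borel cnj borel])
qed

lift_definition cinner :: "L2 \<Rightarrow> L2 \<Rightarrow> complex" is
  "\<lambda>f g. \<integral>z. f z * cnj (g z) \<partial>circle"
proof -
  fix f f' g g' assume *: "L2_rel f f'" "L2_rel g g'"
  show "(\<integral>z. f z * cnj (g z) \<partial>circle) = (\<integral>z. f' z * cnj (g' z) \<partial>circle)"
  proof (rule integral_cong_AE)
    show "AE z in circle. f z * cnj (g z) = f' z * cnj (g' z)"
      using * by (auto simp: L2_rel_def)
  qed (use * in \<open>auto simp: L2_rel_def intro!: borel_measurable_integrable square_int_mult_integrable\<close>)
qed

instantiation L2 :: real_vector
begin
lift_definition zero_L2 :: L2 is "\<lambda>z. 0"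
  by (simp add: L2_rel_def square_int_0)
lift_definition plus_L2 :: "L2 \<Rightarrow> L2 \<Rightarrow> L2" is "\<lambda>f g z. f z + g z"
  by (auto simp: L2_rel_def square_int_add)
lift_definition uminus_L2 :: "L2 \<Rightarrow> L2" is "\<lambda>f z. - f z"
  by (auto simp: L2_rel_def square_int_uminus)
lift_definition minus_L2 :: "L2 \<Rightarrow> L2 \<Rightarrow> L2" is "\<lambda>f g z. f z - g z"
  by (auto simp: L2_rel_def square_int_diff)
lift_definition scaleR_L2 :: "real \<Rightarrow> L2 \<Rightarrow> L2" is "\<lambda>r f z. complex_of_real r * f z"
  by (auto simp: L2_rel_def square_int_scale)
instance
proof
  fix a b c :: L2 and r s :: real
  show "a + b + c = a + (b + c)"
    by transfer (auto simp: L2_rel_def algebra_simps square_int_add)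
  show "a + b = b + a"
    by transfer (auto simp: L2_rel_def algebra_simps square_int_add)
  show "0 + a = a"
    by transfer (auto simp: L2_rel_def)
  show "- a + a = 0"
    by transfer (auto simp: L2_rel_def square_int_0)
  show "a - b = a + - b"
    by transfer (auto simp: L2_rel_def square_int_diff)
  show "r *\<^sub>R (a + b) = r *\<^sub>R a + r *\<^sub>R b"
    by transfer (auto simp: L2_rel_def distrib_left intro!: square_int_add square_int_scale)
  show "(r + s) *\<^sub>R a = r *\<^sub>R a + s *\<^sub>R a"
    by transfer (auto simp: L2_rel_def distrib_right intro!: square_int_add square_int_scale)
  show "r *\<^sub>R s *\<^sub>R a = (r * s) *\<^sub>R a"
    by transfer (auto simp: L2_rel_def mult.assoc intro!: square_int_scale)
  show "1 *\<^sub>R a = a"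
    by transfer (auto simp: L2_rel_def)
qed
end

instantiation L2 :: real_inner
begin
definition inner_L2 :: "L2 \<Rightarrow> L2 \<Rightarrow> real" where
  "inner_L2 f g = Re (cinner f g)"
definition norm_L2 :: "L2 \<Rightarrow> real" where
  "norm_L2 f = sqrt (Re (cinner f f))"
definition dist_L2 :: "L2 \<Rightarrow> L2 \<Rightarrow> real" where
  "dist_L2 f g = norm (f - g)"
definition sgn_L2 :: "L2 \<Rightarrow> L2" where
  "sgn_L2 f = f /\<^sub>R norm f"
definition uniformity_L2 :: "(L2 \<times> L2) filter" where
  "uniformity_L2 = (INF e\<in>{0 <..}. principal {(f, g). dist f g < e})"
definition open_L2 :: "L2 set \<Rightarrow> bool" where
  "open_L2 U = (\<forall>x\<in>U. eventually (\<lambda>(x', y). x' = x \<longrightarrow> y \<in> U) uniformity)"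
instance
proof
  fix x y z :: L2 and r :: real and U :: "L2 set"
  show "dist x y = norm (x - y)" by (rule dist_L2_def)
  show "sgn x = x /\<^sub>R norm x" by (rule sgn_L2_def)
  show "(uniformity :: (L2 \<times> L2) filter) = (INF e\<in>{0 <..}. principal {(f, g). dist f g < e})"
    by (rule uniformity_L2_def)
  show "open U = (\<forall>x\<in>U. eventually (\<lambda>(x', y). x' = x \<longrightarrow> y \<in> U) uniformity)"
    by (rule open_L2_def)
  have *: "cinner x y = cnj (cinner y x)" for x y
    by transfer (simp add: Bochner_Integration.integral_cnj[symmetric] mult.commute
        del: Bochner_Integration.integral_cnj)
  show "inner x y = inner y x"
    using *[of x y] by (simp add: inner_L2_def)
  have "cinner (x + y) z = cinner x z + cinner y z"
    by transfer (simp add: L2_rel_def algebra_simps square_int_mult_integrable)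
  then show "inner (x + y) z = inner x z + inner y z"
    by (simp add: inner_L2_def)
  have "cinner (r *\<^sub>R x) y = complex_of_real r * cinner x y"
    by transfer (simp add: L2_rel_def mult.assoc square_int_mult_integrable)
  then show "inner (r *\<^sub>R x) y = r * inner x y"
    by (simp add: inner_L2_def)
  have sq: "(\<integral>z. f z * cnj (f z) \<partial>circle) = complex_of_real (\<integral>z. (cmod (f z))\<^sup>2 \<partial>circle)" for f
    unfolding complex_norm_square[symmetric] by (rule integral_complex_of_real)
  show "0 \<le> inner x x"
    unfolding inner_L2_def by transfer (simp add: sq del: of_real_power)
  show "(inner x x = 0) = (x = 0)"
    unfolding inner_L2_def
  proof transfer
    fix f assume f: "L2_rel f f"
    then have "(\<integral>z. (cmod (f z))\<^sup>2 \<partial>circle) = 0 \<longleftrightarrow> (AE z in circle. (cmod (f z))\<^sup>2 = 0)"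
      by (intro integral_nonneg_eq_0_iff_AE) (auto simp: L2_rel_def square_int_def)
    then show "(Re (\<integral>z. f z * cnj (f z) \<partial>circle) = 0) = L2_rel f (\<lambda>z. 0)"
      using f by (simp add: sq L2_rel_def square_int_0 del: of_real_power)
  qed
  show "norm x = sqrt (inner x x)"
    by (simp add: norm_L2_def inner_L2_def)
qed
end

lemma L2_cases:
  obtains f where "square_int f" "x = abs_L2 f"
proof
  have "L2_rel (rep_L2 x) (rep_L2 x)" by (rule Quotient3_rep_reflp[OF Quotient3_L2])
  then show "square_int (rep_L2 x)" by (simp add: L2_rel_def)
  show "x = abs_L2 (rep_L2 x)" by (simp add: Quotient3_abs_rep[OF Quotient3_L2])
qed

lemma norm_abs_L2:
  assumes "square_int f"
  shows "norm (abs_L2 f) = sqrt (\<integral>z. (cmod (f z))\<^sup>2 \<partial>circle)"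
proof -
  have *: "L2_rel f f" using assms by (simp add: L2_rel_def)
  have "(\<integral>z. f z * cnj (f z) \<partial>circle) = complex_of_real (\<integral>z. (cmod (f z))\<^sup>2 \<partial>circle)"
    unfolding complex_norm_square[symmetric] by (rule integral_complex_of_real)
  then show ?thesis
    by (simp add: norm_L2_def cinner.abs_eq[OF * *])
qed

lemma norm_diff_abs_L2:
  assumes "square_int f" "square_int g"
  shows "norm (abs_L2 f - abs_L2 g) = sqrt (\<integral>z. (cmod (f z - g z))\<^sup>2 \<partial>circle)"
  using assms norm_abs_L2[OF square_int_diff[OF assms]]
  by (simp add: minus_L2.abs_eq L2_rel_def)

lemma nn_integral_diff_abs_L2:
  assumes "square_int f" "square_int g"
  shows "(\<integral>\<^sup>+z. ennreal ((cmod (f z - g z))\<^sup>2) \<partial>circle) = ennreal ((norm (abs_L2 f - abs_L2 g))\<^sup>2)"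
proof -
  have "integrable circle (\<lambda>z. (cmod (f z - g z))\<^sup>2)"
    using square_int_diff[OF assms] by (simp add: square_int_def)
  then show ?thesis
    by (subst nn_integral_eq_integral) (auto simp: norm_diff_abs_L2[OF assms])
qed

text \<open>Riesz--Fischer.\<close>

lemma Cauchy_L2_convergent:
  fixes X :: "nat \<Rightarrow> L2"
  assumes X: "Cauchy X"
  shows "convergent X"
proof -
  have "\<exists>f. square_int f \<and> X n = abs_L2 f" for n
    by (rule L2_cases[of "X n"]) auto
  then obtain F where F: "\<And>n. square_int (F n)" and XF: "\<And>n. X n = abs_L2 (F n)"
    by metis
  note [measurable] = F[THEN square_int_measurable]
  have "\<exists>M. \<forall>m\<ge>M. \<forall>n\<ge>M. norm (X m - X n) < (1/2)^k" for k :: nat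
    using CauchyD[OF X, of "(1/2)^k"] by auto
  then obtain M where M: "\<And>k m n. m \<ge> M k \<Longrightarrow> n \<ge> M k \<Longrightarrow> norm (X m - X n) < (1/2)^k"
    by metis
  define r where "r k = (\<Sum>i\<le>k. M i) + k" for k
  have rM: "r k \<ge> M k" for k
    unfolding r_def by (rule trans_le_add1, rule member_le_sum) auto
  have rmono: "r k \<le> r (Suc k)" for k
    by (simp add: r_def)
  have rk: "r k \<ge> k" for k
    by (simp add: r_def)
  define G where "G k = F (r k)" for k
  have G: "square_int (G k)" for k by (simp add: G_def F)
  note [measurable] = G[THEN square_int_measurable]
  define a where "a k z = cmod (G (Suc k) z - G k z)" for k z
  have [measurable]: "a k \<in> borel_measurable circle" for k
    unfolding a_def by measurable
  have a_bound: "(\<integral>\<^sup>+z. ennreal (a k z) \<partial>circle) \<le> ennreal (2 * (1/2)^k)" for k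
  proof -
    have "(\<integral>\<^sup>+z. ennreal (a k z) \<partial>circle)
        \<le> (\<integral>\<^sup>+z. ennreal (2^k) * ennreal ((a k z)\<^sup>2) + ennreal ((1/2)^k) \<partial>circle)"
    proof (rule nn_integral_mono)
      fix z
      have "0 \<le> (2^k * a k z - 1)\<^sup>2" by simp
      then have "2 * (2^k * a k z) \<le> 2^k * 2^k * (a k z)\<^sup>2 + 1"
        by (simp add: power2_diff power_mult_distrib power2_eq_square algebra_simps)
      moreover have "0 \<le> 2^k * a k z" by (simp add: a_def)
      ultimately have "2^k * a k z \<le> 2^k * (2^k * (a k z)\<^sup>2 + (1/2)^k)"
        by (simp add: distrib_left power_one_over mult.assoc)
      then have "a k z \<le> 2^k * (a k z)\<^sup>2 + (1/2)^k"
        by (subst (asm) mult_le_cancel_left_pos) auto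
      then show "ennreal (a k z) \<le> ennreal (2^k) * ennreal ((a k z)\<^sup>2) + ennreal ((1/2)^k)"
        by (simp add: ennreal_leI flip: ennreal_mult ennreal_plus)
    qed
    also have "\<dots> = ennreal (2^k) * (\<integral>\<^sup>+z. ennreal ((a k z)\<^sup>2) \<partial>circle) + ennreal ((1/2)^k)"
      by (simp add: nn_integral_add nn_integral_cmult emeasure_circle)
    also have "(\<integral>\<^sup>+z. ennreal ((a k z)\<^sup>2) \<partial>circle) = ennreal ((norm (X (r (Suc k)) - X (r k)))\<^sup>2)"
      unfolding a_def XF using nn_integral_diff_abs_L2[OF G G] by (simp add: G_def)
    also have "\<dots> \<le> ennreal (((1/2)^k)\<^sup>2)"
    proof (intro ennreal_leI power_mono)
      have "norm (X (r (Suc k)) - X (r k)) < (1/2)^k"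
        using rM[of k] rmono[of k] by (intro M) auto
      then show "norm (X (r (Suc k)) - X (r k)) \<le> (1/2)^k" by simp
    qed auto
    also have "ennreal (2^k) * ennreal (((1/2)^k)\<^sup>2) + ennreal ((1/2)^k) = ennreal (2 * (1/2)^k)"
      by (simp add: power2_eq_square power_one_over flip: ennreal_mult ennreal_plus)
    finally show ?thesis by (simp add: mult_left_mono add_right_mono)
  qed
  have "(\<integral>\<^sup>+z. (\<Sum>k. ennreal (a k z)) \<partial>circle) = (\<Sum>k. \<integral>\<^sup>+z. ennreal (a k z) \<partial>circle)"
    by (rule nn_integral_suminf) measurable
  also have "\<dots> \<le> (\<Sum>k. ennreal (2 * (1/2)^k))"
    by (intro suminf_le a_bound) auto
  also have "\<dots> = ennreal (\<Sum>k. 2 * (1/2)^k)"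
    by (rule suminf_ennreal2) (auto intro!: summable_mult summable_geometric)
  also have "\<dots> < \<infinity>" by simp
  finally have "AE z in circle. (\<Sum>k. ennreal (a k z)) \<noteq> \<infinity>"
    by (intro nn_integral_noteq_infinite) auto
  then have conv: "AE z in circle. convergent (\<lambda>k. G k z)"
  proof eventually_elim
    case (elim z)
    have "summable (\<lambda>k. a k z)"
      by (rule summable_suminf_not_top) (use elim in \<open>auto simp: a_def\<close>)
    then have "summable (\<lambda>k. G (Suc k) z - G k z)"
      unfolding a_def by (rule summable_norm_cancel)
    then have "convergent (\<lambda>n. \<Sum>k<n. G (Suc k) z - G k z)"
      by (simp add: summable_iff_convergent)
    then have "convergent (\<lambda>n. (G n z - G 0 z) + G 0 z)"
      by (intro convergent_add convergent_const) (simp add: sum_lessThan_telescope[of "\<lambda>n. G n z"])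
    then show ?case by simp
  qed
  define H where "H z = lim (\<lambda>k. G k z)" for z
  have [measurable]: "H \<in> borel_measurable circle"
    unfolding H_def by (rule borel_measurable_lim_metric) measurable
  have lim: "AE z in circle. (\<lambda>k. G k z) \<longlonglongrightarrow> H z"
    using conv by eventually_elim (simp add: H_def convergent_LIMSEQ_iff)
  have fatou: "(\<integral>\<^sup>+z. ennreal ((cmod (H z - F m z))\<^sup>2) \<partial>circle) \<le> ennreal (((1/2)^k)\<^sup>2)"
    if "m \<ge> M k" for m k
  proof -
    have "(\<integral>\<^sup>+z. ennreal ((cmod (H z - F m z))\<^sup>2) \<partial>circle)
        = (\<integral>\<^sup>+z. liminf (\<lambda>n. ennreal ((cmod (G n z - F m z))\<^sup>2)) \<partial>circle)"
    proof (rule nn_integral_cong_AE)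
      show "AE z in circle. ennreal ((cmod (H z - F m z))\<^sup>2)
          = liminf (\<lambda>n. ennreal ((cmod (G n z - F m z))\<^sup>2))"
        using lim
      proof eventually_elim
        case (elim z)
        then have "(\<lambda>n. ennreal ((cmod (G n z - F m z))\<^sup>2)) \<longlonglongrightarrow> ennreal ((cmod (H z - F m z))\<^sup>2)"
          by (intro tendsto_intros)
        then show ?case by (rule lim_imp_Liminf[symmetric, rotated]) simp
      qed
    qed
    also have "\<dots> \<le> liminf (\<lambda>n. \<integral>\<^sup>+z. ennreal ((cmod (G n z - F m z))\<^sup>2) \<partial>circle)"
      by (rule nn_integral_liminf) measurable
    also have "\<dots> \<le> liminf (\<lambda>n. ennreal (((1/2)^k)\<^sup>2))"
    proof (rule Liminf_mono)
      show "\<forall>\<^sub>F n in sequentially. (\<integral>\<^sup>+z. ennreal ((cmod (G n z - F m z))\<^sup>2) \<partial>circle)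
          \<le> ennreal (((1/2)^k)\<^sup>2)"
        using eventually_ge_at_top[of "M k"]
      proof eventually_elim
        case (elim n)
        have "norm (X (r n) - X m) < (1/2)^k"
          using elim rk[of n] that by (intro M) auto
        then show ?case
          unfolding nn_integral_diff_abs_L2[OF G F] by (auto simp: G_def XF intro!: ennreal_leI power_mono)
      qed
    qed
    also have "\<dots> = ennreal (((1/2)^k)\<^sup>2)"
      by (simp add: Liminf_const)
    finally show ?thesis .
  qed
  have "square_int (\<lambda>z. H z - F (M 0) z)"
  proof -
    have "integrable circle (\<lambda>z. (cmod (H z - F (M 0) z))\<^sup>2)"
      by (rule integrableI_bounded) (use fatou[of 0 "M 0"] in \<open>auto intro: le_less_trans\<close>)
    then show ?thesis by (simp add: square_int_def)
  qed
  from square_int_add[OF this F[of "M 0"]] have H: "square_int H" by simp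
  have HX: "norm (X m - abs_L2 H) \<le> (1/2)^k" if "m \<ge> M k" for m k
  proof -
    have "ennreal ((norm (X m - abs_L2 H))\<^sup>2) \<le> ennreal (((1/2)^k)\<^sup>2)"
      using fatou[OF that] unfolding nn_integral_diff_abs_L2[OF H F] XF
      by (simp add: norm_minus_commute)
    then have "(norm (X m - abs_L2 H))\<^sup>2 \<le> ((1/2)^k)\<^sup>2"
      by (subst (asm) ennreal_le_iff) auto
    then show ?thesis by (rule power2_le_imp_le) simp
  qed
  have "X \<longlonglongrightarrow> abs_L2 H"
  proof (rule LIMSEQ_I)
    fix e :: real assume "0 < e"
    then obtain k where "(1/2)^k < e"
      using real_arch_pow_inv[of e "1/2"] by auto
    then show "\<exists>no. \<forall>n\<ge>no. norm (X n - abs_L2 H) < e"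
      using HX by (meson le_less_trans)
  qed
  then show ?thesis by (rule convergentI)
qed

instance L2 :: banach
  by standard (rule Cauchy_L2_convergent)

section \<open>Complex Banach spaces, operators, equivalence after extension\<close>

class complex_banach = banach +
  fixes scaleC :: "complex \<Rightarrow> 'a \<Rightarrow> 'a" (infixr "*\<^sub>C" 75)
  assumes scaleC_add_right: "a *\<^sub>C (x + y) = a *\<^sub>C x + a *\<^sub>C y"
    and scaleC_add_left: "(a + b) *\<^sub>C x = a *\<^sub>C x + b *\<^sub>C x"
    and scaleC_scaleC: "a *\<^sub>C b *\<^sub>C x = (a * b) *\<^sub>C x"
    and scaleC_of_real: "complex_of_real r *\<^sub>C x = r *\<^sub>R x"
    and norm_scaleC: "norm (a *\<^sub>C x) = cmod a * norm x"

instantiation prod :: (complex_banach, complex_banach) complex_banach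
begin
definition scaleC_prod :: "complex \<Rightarrow> 'a \<times> 'b \<Rightarrow> 'a \<times> 'b" where
  "scaleC_prod c x = (c *\<^sub>C fst x, c *\<^sub>C snd x)"
instance
proof
  fix a b :: complex and r :: real and x y :: "'a \<times> 'b"
  show "a *\<^sub>C (x + y) = a *\<^sub>C x + a *\<^sub>C y" "(a + b) *\<^sub>C x = a *\<^sub>C x + b *\<^sub>C x"
    "a *\<^sub>C b *\<^sub>C x = (a * b) *\<^sub>C x" "complex_of_real r *\<^sub>C x = r *\<^sub>R x"
    by (simp_all add: scaleC_prod_def prod_eq_iff scaleC_add_right scaleC_add_left
        scaleC_scaleC scaleC_of_real)
  have "(norm (a *\<^sub>C x))\<^sup>2 = (cmod a * norm x)\<^sup>2"
    by (simp add: scaleC_prod_def norm_prod_def norm_scaleC power_mult_distrib distrib_left)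
  then show "norm (a *\<^sub>C x) = cmod a * norm x"
    by (simp add: power2_eq_iff_nonneg)
qed
end

instantiation L2 :: complex_banach
begin
lift_definition scaleC_L2 :: "complex \<Rightarrow> L2 \<Rightarrow> L2" is "\<lambda>c f z. c * f z"
  by (auto simp: L2_rel_def square_int_scale)
instance
proof
  fix a b :: complex and r :: real and x y :: L2
  show "a *\<^sub>C (x + y) = a *\<^sub>C x + a *\<^sub>C y"
    by transfer (auto simp: L2_rel_def distrib_left intro!: square_int_add square_int_scale)
  show "(a + b) *\<^sub>C x = a *\<^sub>C x + b *\<^sub>C x"
    by transfer (auto simp: L2_rel_def distrib_right intro!: square_int_add square_int_scale)
  show "a *\<^sub>C b *\<^sub>C x = (a * b) *\<^sub>C x"
    by transfer (auto simp: L2_rel_def mult.assoc intro!: square_int_scale)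
  show "complex_of_real r *\<^sub>C x = r *\<^sub>R x"
    by transfer (auto simp: L2_rel_def intro!: square_int_scale)
  obtain f where f: "square_int f" and x: "x = abs_L2 f"
    by (rule L2_cases)
  have "a *\<^sub>C x = abs_L2 (\<lambda>z. a * f z)"
    using f by (simp add: x scaleC_L2.abs_eq L2_rel_def)
  then show "norm (a *\<^sub>C x) = cmod a * norm x"
    using f by (simp add: x norm_abs_L2 square_int_scale norm_mult power_mult_distrib real_sqrt_mult)
qed
end

text \<open>Banach spaces are represented as closed complex-linear subspaces of a type of class
  \<^class>\<open>complex_banach\<close>; operators between them are functions on the ambient types
  of which only the values on the subspace matter. The direct sum of \<open>X\<close> and \<open>Y\<close> is \<open>X \<times> Y\<close>
  with the (Hilbertian) norm of the product type.\<close>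

definition closed_csubspace :: "'a::complex_banach set \<Rightarrow> bool" where
  "closed_csubspace X \<longleftrightarrow> closed X \<and> 0 \<in> X \<and> (\<forall>x\<in>X. \<forall>y\<in>X. x + y \<in> X) \<and> (\<forall>c. \<forall>x\<in>X. c *\<^sub>C x \<in> X)"

definition bounded_op :: "'a::complex_banach set \<Rightarrow> 'b::complex_banach set \<Rightarrow> ('a \<Rightarrow> 'b) \<Rightarrow> bool" where
  "bounded_op X Y T \<longleftrightarrow>
     (\<forall>x\<in>X. T x \<in> Y) \<and>
     (\<forall>x\<in>X. \<forall>y\<in>X. T (x + y) = T x + T y) \<and>
     (\<forall>c. \<forall>x\<in>X. T (c *\<^sub>C x) = c *\<^sub>C T x) \<and>
     (\<exists>C. \<forall>x\<in>X. norm (T x) \<le> C * norm x)"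

definition invertible_op :: "'a::complex_banach set \<Rightarrow> 'b::complex_banach set \<Rightarrow> ('a \<Rightarrow> 'b) \<Rightarrow> bool" where
  "invertible_op X Y T \<longleftrightarrow> bounded_op X Y T \<and>
     (\<exists>R. bounded_op Y X R \<and> (\<forall>x\<in>X. R (T x) = x) \<and> (\<forall>y\<in>Y. T (R y) = y))"

text \<open>HOL cannot quantify existentially over types, so the ambient types \<open>'e\<close> and \<open>'f\<close> of the
  auxiliary spaces \<open>X\<^sub>0\<close> and \<open>Y\<^sub>0\<close> are parameters. Any choice of them gives a sufficient condition
  for the existence of auxiliary Banach spaces.\<close>

definition equivalent_after_extension ::
  "'e::complex_banach itself \<Rightarrow> 'f::complex_banach itself \<Rightarrow>
   'a::complex_banach set \<Rightarrow> 'b::complex_banach set \<Rightarrow> ('a \<Rightarrow> 'b) \<Rightarrow>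
   'c::complex_banach set \<Rightarrow> 'd::complex_banach set \<Rightarrow> ('c \<Rightarrow> 'd) \<Rightarrow> bool" where
  "equivalent_after_extension _ _ X X' T Y Y' S \<longleftrightarrow>
     closed_csubspace X \<and> closed_csubspace X' \<and> bounded_op X X' T \<and>
     closed_csubspace Y \<and> closed_csubspace Y' \<and> bounded_op Y Y' S \<and>
     (\<exists>(X\<^sub>0 :: 'e set) (Y\<^sub>0 :: 'f set) E F.
        closed_csubspace X\<^sub>0 \<and> closed_csubspace Y\<^sub>0 \<and>
        invertible_op (Y' \<times> Y\<^sub>0) (X' \<times> X\<^sub>0) E \<and>
        invertible_op (X \<times> X\<^sub>0) (Y \<times> Y\<^sub>0) F \<and>
        (\<forall>u \<in> X \<times> X\<^sub>0. map_prod T id u = E (map_prod S id (F u))))"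

section \<open>The algebra of essentially bounded functions and its action on L2\<close>

definition ess_bounded :: "(complex \<Rightarrow> complex) \<Rightarrow> bool" where
  "ess_bounded f \<longleftrightarrow> f \<in> borel_measurable circle \<and> (\<exists>C. AE z in circle. cmod (f z) \<le> C)"

definition Linf_rel :: "(complex \<Rightarrow> complex) \<Rightarrow> (complex \<Rightarrow> complex) \<Rightarrow> bool" where
  "Linf_rel f g \<longleftrightarrow> ess_bounded f \<and> ess_bounded g \<and> (AE z in circle. f z = g z)"

lemma ess_bounded_const: "ess_bounded (\<lambda>z. c)"
  by (auto simp: ess_bounded_def)

lemma ess_bounded_measurable [measurable_dest]: "ess_bounded f \<Longrightarrow> f \<in> borel_measurable circle"
  by (simp add: ess_bounded_def)

quotient_type Linf = "complex \<Rightarrow> complex" / partial: Linf_rel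
proof (rule part_equivpI)
  show "\<exists>f. Linf_rel f f"
    by (rule exI[of _ "\<lambda>z. 0"]) (simp add: Linf_rel_def ess_bounded_const)
  show "symp Linf_rel"
    by (rule sympI) (auto simp: Linf_rel_def elim: AE_mp)
  show "transp Linf_rel"
    by (rule transpI) (auto simp: Linf_rel_def elim: AE_mp)
qed

lemma ess_bounded_add:
  assumes "ess_bounded f" "ess_bounded g" shows "ess_bounded (\<lambda>z. f z + g z)"
proof -
  obtain C D where C: "AE z in circle. cmod (f z) \<le> C" and D: "AE z in circle. cmod (g z) \<le> D"
    using assms by (auto simp: ess_bounded_def)
  from C D have "AE z in circle. cmod (f z + g z) \<le> C + D"
    by eventually_elim (rule norm_triangle_mono)
  then show ?thesis
    using assms unfolding ess_bounded_def by auto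
qed

lemma ess_bounded_mult:
  assumes "ess_bounded f" "ess_bounded g" shows "ess_bounded (\<lambda>z. f z * g z)"
proof -
  obtain C D where C: "AE z in circle. cmod (f z) \<le> C" and D: "AE z in circle. cmod (g z) \<le> D"
    using assms by (auto simp: ess_bounded_def)
  from C D have "AE z in circle. cmod (f z * g z) \<le> C * D"
    by eventually_elim (auto simp: norm_mult intro!: mult_mono intro: order_trans[OF norm_ge_zero])
  then show ?thesis
    using assms unfolding ess_bounded_def by auto
qed

lemma ess_bounded_uminus: "ess_bounded f \<Longrightarrow> ess_bounded (\<lambda>z. - f z)"
  using ess_bounded_mult[OF ess_bounded_const[of "-1"]] by simp

lemma ess_bounded_diff: "ess_bounded f \<Longrightarrow> ess_bounded g \<Longrightarrow> ess_bounded (\<lambda>z. f z - g z)"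
  using ess_bounded_add[of f "\<lambda>z. - g z"] ess_bounded_uminus[of g] by simp

lemma ess_bounded_cnj: "ess_bounded f \<Longrightarrow> ess_bounded (\<lambda>z. cnj (f z))"
  using borel_measurable_continuous_onI[OF continuous_on_cnj[OF continuous_on_id]]
  by (auto simp: ess_bounded_def intro: measurable_compose[of f circle borel cnj borel])

lemma square_int_ess_bounded_mult:
  assumes f: "ess_bounded f" and g: "square_int g" shows "square_int (\<lambda>z. f z * g z)"
proof -
  note [measurable] = ess_bounded_measurable[OF f] square_int_measurable[OF g]
  obtain C where C: "AE z in circle. cmod (f z) \<le> C"
    using f by (auto simp: ess_bounded_def)
  have "integrable circle (\<lambda>z. (cmod (f z * g z))\<^sup>2)"
  proof (rule Bochner_Integration.integrable_bound)
    show "integrable circle (\<lambda>z. C\<^sup>2 * (cmod (g z))\<^sup>2)"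
      using g by (auto simp: square_int_def)
    show "AE z in circle. norm ((cmod (f z * g z))\<^sup>2) \<le> norm (C\<^sup>2 * (cmod (g z))\<^sup>2)"
      using C by eventually_elim
        (auto simp: norm_mult power_mult_distrib intro!: mult_right_mono power_mono)
  qed measurable
  then show ?thesis by (simp add: square_int_def)
qed

lemma square_int_1: "square_int (\<lambda>z. 1)"
proof -
  interpret finite_measure circle by (rule finite_measure_circle)
  show ?thesis by (simp add: square_int_def)
qed

lemma square_int_ess_bounded: "ess_bounded f \<Longrightarrow> square_int f"
  using square_int_ess_bounded_mult[OF _ square_int_1] by simp

instantiation Linf :: comm_ring_1
begin
lift_definition zero_Linf :: Linf is "\<lambda>z. 0"
  by (simp add: Linf_rel_def ess_bounded_const)
lift_definition one_Linf :: Linf is "\<lambda>z. 1"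
  by (simp add: Linf_rel_def ess_bounded_const)
lift_definition plus_Linf :: "Linf \<Rightarrow> Linf \<Rightarrow> Linf" is "\<lambda>f g z. f z + g z"
  by (auto simp: Linf_rel_def ess_bounded_add)
lift_definition times_Linf :: "Linf \<Rightarrow> Linf \<Rightarrow> Linf" is "\<lambda>f g z. f z * g z"
  by (auto simp: Linf_rel_def ess_bounded_mult)
lift_definition uminus_Linf :: "Linf \<Rightarrow> Linf" is "\<lambda>f z. - f z"
  by (auto simp: Linf_rel_def ess_bounded_uminus)
lift_definition minus_Linf :: "Linf \<Rightarrow> Linf \<Rightarrow> Linf" is "\<lambda>f g z. f z - g z"
  by (auto simp: Linf_rel_def ess_bounded_diff)
instance
proof
  fix a b c :: Linf
  show "a + b + c = a + (b + c)"
    by transfer (auto simp: Linf_rel_def add.assoc intro!: ess_bounded_add)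
  show "a + b = b + a"
    by transfer (auto simp: Linf_rel_def add.commute intro!: ess_bounded_add)
  show "0 + a = a"
    by transfer (auto simp: Linf_rel_def)
  show "- a + a = 0"
    by transfer (auto simp: Linf_rel_def ess_bounded_const)
  show "a - b = a + - b"
    by transfer (auto simp: Linf_rel_def ess_bounded_diff)
  show "a * b * c = a * (b * c)"
    by transfer (auto simp: Linf_rel_def mult.assoc intro!: ess_bounded_mult)
  show "a * b = b * a"
    by transfer (auto simp: Linf_rel_def mult.commute intro!: ess_bounded_mult)
  show "1 * a = a"
    by transfer (auto simp: Linf_rel_def)
  show "(a + b) * c = a * c + b * c"
    by transfer (auto simp: Linf_rel_def distrib_right intro!: ess_bounded_mult ess_bounded_add)
  have "emeasure circle (space circle) \<noteq> 0"
    by (simp add: emeasure_circle)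
  then have "\<not> (AE z in circle. False)"
    by (subst AE_iff_measurable[OF sets.top]) auto
  then show "0 \<noteq> (1 :: Linf)"
    by transfer (simp add: Linf_rel_def)
qed
end

lift_definition Linf_cnj :: "Linf \<Rightarrow> Linf" is "\<lambda>f z. cnj (f z)"
  by (auto simp: Linf_rel_def ess_bounded_cnj)

lift_definition Linf_mult :: "Linf \<Rightarrow> L2 \<Rightarrow> L2" (infixr "\<odot>" 70) is "\<lambda>f g z. f z * g z"
  by (auto simp: Linf_rel_def L2_rel_def square_int_ess_bounded_mult)

lift_definition L2_of_Linf :: "Linf \<Rightarrow> L2" is "\<lambda>f. f"
  by (auto simp: Linf_rel_def L2_rel_def square_int_ess_bounded)

lift_definition unimodular :: "Linf \<Rightarrow> bool" is "\<lambda>f. AE z in circle. cmod (f z) = 1"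
  by (auto simp: Linf_rel_def elim: AE_mp)

section \<open>Hardy space, inner functions and model spaces\<close>

lemma square_int_powi: "square_int (\<lambda>z. z powi n)"
proof -
  have [measurable]: "(\<lambda>z::complex. z powi n) \<in> borel_measurable borel"
    unfolding power_int_def by measurable
  have "AE z in circle. cmod (z powi n) \<le> 1"
    by (rule AE_I2) (simp add: space_circle norm_power_int)
  then have "ess_bounded (\<lambda>z. z powi n)"
    by (auto simp: ess_bounded_def intro!: borel_measurable_circle)
  then show ?thesis by (rule square_int_ess_bounded)
qed

lift_definition monomial :: "int \<Rightarrow> L2" is "\<lambda>n z. z powi n"
  by (simp add: L2_rel_def square_int_powi)

definition fourier_coeff :: "L2 \<Rightarrow> int \<Rightarrow> complex" where
  "fourier_coeff f n = cinner f (monomial n)"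

text \<open>A power series with square-summable coefficients on the disk is identified with its boundary
  function, the element of \<^typ>\<open>L2\<close> with the same nonnegative Fourier coefficients and vanishing
  negative ones.\<close>

definition H2 :: "L2 set" where
  "H2 = {f. \<forall>n<0. fourier_coeff f n = 0}"

text \<open>The bounded analytic functions are, through their boundary values, the elements of the
  intersection of \<^typ>\<open>Linf\<close> with the Hardy space.\<close>

definition inner_function :: "Linf \<Rightarrow> bool" where
  "inner_function \<alpha> \<longleftrightarrow> L2_of_Linf \<alpha> \<in> H2 \<and> unimodular \<alpha>"

definition orth_comp :: "L2 set \<Rightarrow> L2 set" where
  "orth_comp S = {f. \<forall>g\<in>S. cinner f g = 0}"

text \<open>Only meaningful when \<open>S\<close> is a closed subspace.\<close>

definition orth_proj :: "L2 set \<Rightarrow> L2 \<Rightarrow> L2" where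
  "orth_proj S f = (THE g. g \<in> S \<and> f - g \<in> orth_comp S)"

definition P_plus :: "L2 \<Rightarrow> L2" where
  "P_plus = orth_proj H2"

definition P_minus :: "L2 \<Rightarrow> L2" where
  "P_minus f = f - P_plus f"

definition model_space :: "Linf \<Rightarrow> L2 set" where
  "model_space \<theta> = H2 \<inter> orth_comp ((\<odot>) \<theta> ` H2)"

definition model_space_perp :: "Linf \<Rightarrow> L2 set" where
  "model_space_perp \<theta> = orth_comp (model_space \<theta>)"

definition Q_proj :: "Linf \<Rightarrow> L2 \<Rightarrow> L2" where
  "Q_proj \<theta> f = f - orth_proj (model_space \<theta>) f"

section \<open>Dual truncated Toeplitz operators and paired operators\<close>

text \<open>As an operator, this is restricted to \<open>model_space_perp \<theta>\<close>; its formula does not otherwise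
  depend on the domain parameter \<open>\<theta>\<close>.\<close>

definition dual_truncated_toeplitz :: "Linf \<Rightarrow> Linf \<Rightarrow> L2 \<Rightarrow> L2" where
  "dual_truncated_toeplitz \<phi> \<alpha> f = Q_proj \<alpha> (\<phi> \<odot> f)"

definition matrix_op :: "Linf^2^2 \<Rightarrow> L2 \<times> L2 \<Rightarrow> L2 \<times> L2" where
  "matrix_op M u = (M$1$1 \<odot> fst u + M$1$2 \<odot> snd u, M$2$1 \<odot> fst u + M$2$2 \<odot> snd u)"

definition paired_op :: "Linf^2^2 \<Rightarrow> Linf^2^2 \<Rightarrow> L2 \<times> L2 \<Rightarrow> L2 \<times> L2" where
  "paired_op A B u =
     matrix_op A (map_prod P_plus P_plus u) + matrix_op B (map_prod P_minus P_minus u)"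

end

theory Submission
  imports Defs
begin

text \<open>
  Write \<open>P\<^sub>+\<close>, \<open>P\<^sub>-\<close> for the projections onto the Hardy space and its complement, and \<open>\<psi>\<close> for the product of \<open>\<phi>\<close> with the conjugate of
  \<open>\<alpha>\<close>. The paired operator depends on its first argument \<open>u\<close> only through \<open>f = P\<^sub>- u + \<theta> P\<^sub>+ u\<close>, and
  \<open>u \<mapsto> f\<close> is an isomorphism of \<open>L2\<close> onto the complement of the model space of \<open>\<theta>\<close>. In terms of \<open>f\<close>
  the paired operator sends \<open>(u, v)\<close> to \<open>(a, b)\<close> with \<open>a = \<phi> f - P\<^sub>+ v\<close> and \<open>b = \<psi> f - P\<^sub>- v\<close>.

  The pair \<open>(a, b)\<close> is the same information as its four halves. Two of them are free of \<open>v\<close>: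
  \<open>P\<^sub>- a + \<alpha> P\<^sub>+ b = P\<^sub>- (\<phi> f) + \<alpha> P\<^sub>+ (\<psi> f)\<close>, which is the dual truncated Toeplitz operator applied to
  \<open>f\<close>. The other two combine to \<open>P\<^sub>+ a + P\<^sub>- b = P\<^sub>+ (\<phi> f) + P\<^sub>- (\<psi> f) - v\<close>, which for each \<open>f\<close>
  determines \<open>v\<close>. Hence the paired operator is, up to invertible operators on both sides, the
  direct sum of the dual truncated Toeplitz operator and the identity of \<open>L2\<close>. One auxiliary space
  is \<open>L2\<close>, the other one is trivial.

  The analysis lies in the facts about inner functions behind this computation: that \<open>\<alpha>\<close> multiplies
  the Hardy space into itself (\<open>inner_function_mult_H2\<close>), and that the projection onto the complement of
  the model space is \<open>f \<mapsto> P\<^sub>- f + \<alpha> P\<^sub>+ g\<close>, where \<open>g\<close> is \<open>f\<close> multiplied by the conjugate of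
  \<open>\<alpha>\<close> (\<open>Q_proj_eq\<close>). Since the Hardy space is given by vanishing Fourier coefficients, the
  first fact depends on the completeness of the trigonometric system
  (\<open>L2_eq_0_if_fourier_coeffs_0\<close>), and both depend on the existence of orthogonal projections
  (\<open>orth_proj_props\<close>).
\<close>

section \<open>The complex inner product and closed subspaces\<close>

lemma cinner_commute: "cinner x y = cnj (cinner y x)"
  by transfer (simp add: Bochner_Integration.integral_cnj[symmetric] mult.commute
      del: Bochner_Integration.integral_cnj)

lemma cinner_add_left: "cinner (x + y) z = cinner x z + cinner y z"
  by transfer (simp add: L2_rel_def algebra_simps square_int_mult_integrable)

lemma cinner_scaleC_left: "cinner (c *\<^sub>C x) y = c * cinner x y"
  by transfer (simp add: L2_rel_def mult.assoc square_int_mult_integrable)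

lemma cinner_diff_left: "cinner (x - y) z = cinner x z - cinner y z"
  using cinner_add_left[of "x - y" y z] by simp

lemma cinner_zero_left [simp]: "cinner 0 y = 0"
  using cinner_diff_left[of 0 0 y] by simp

lemma cinner_scaleC_right: "cinner x (c *\<^sub>C y) = cnj c * cinner x y"
  using cinner_scaleC_left[of c y x] by (metis cinner_commute complex_cnj_mult)

text \<open>Complex orthogonality amounts to two real orthogonality relations, so real inner product
  arguments apply to the complex form.\<close>

lemma cinner_eq_inner: "cinner x y = Complex (inner x y) (inner x (\<i> *\<^sub>C y))"
  by (simp add: complex_eq_iff inner_L2_def cinner_scaleC_right)

lemma cinner_self_eq_0_iff: "cinner x x = 0 \<longleftrightarrow> x = 0"
  by (metis inner_L2_def inner_eq_zero_iff cinner_zero_left zero_complex.sel(1))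

lemma closed_csubspace_orth_comp: "closed_csubspace (orth_comp S)"
proof -
  have "orth_comp S = (\<Inter>g\<in>S. {f. inner f g = 0} \<inter> {f. inner f (\<i> *\<^sub>C g) = 0})"
    by (auto simp: orth_comp_def cinner_eq_inner complex_eq_iff)
  also have "closed \<dots>"
    by (intro closed_INT ballI closed_Int closed_Collect_eq continuous_intros)
  finally show ?thesis
    by (auto simp: closed_csubspace_def orth_comp_def cinner_add_left cinner_scaleC_left)
qed

lemma scaleC_minus_one: "(-1) *\<^sub>C x = - (x :: 'a::complex_banach)"
  using scaleC_of_real[of "-1" x] by simp

lemma closed_csubspace_diff:
  assumes "closed_csubspace X" "x \<in> X" "y \<in> X" shows "x - y \<in> X"
  using assms unfolding closed_csubspace_def
  by (metis scaleC_minus_one add_uminus_conv_diff)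

lemma closed_csubspace_scaleR:
  assumes "closed_csubspace X" "x \<in> X" shows "r *\<^sub>R x \<in> X"
  using assms unfolding closed_csubspace_def by (metis scaleC_of_real)

lemma H2_eq_orth_comp: "H2 = orth_comp (monomial ` {..<0})"
  by (auto simp: H2_def orth_comp_def fourier_coeff_def)

lemma closed_csubspace_H2: "closed_csubspace H2"
  unfolding H2_eq_orth_comp by (rule closed_csubspace_orth_comp)

section \<open>Orthogonal projections onto closed subspaces\<close>

text \<open>A minimizing sequence is Cauchy by the parallelogram law: the midpoint of two of its terms
  stays in the subspace, hence at distance at least \<open>d\<close> from \<open>f\<close>.\<close>

lemma closest_point_exists_L2:
  fixes X :: "L2 set"
  assumes X: "closed_csubspace X"
  obtains g where "g \<in> X" "\<And>h. h \<in> X \<Longrightarrow> norm (f - g) \<le> norm (f - h)"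
proof -
  define d where "d = (INF h\<in>X. norm (f - h))"
  have bdd: "bdd_below ((\<lambda>h. norm (f - h)) ` X)" by (intro bdd_belowI[of _ 0]) auto
  have ne: "X \<noteq> {}" using X by (auto simp: closed_csubspace_def)
  have d: "d \<le> norm (f - h)" if "h \<in> X" for h
    unfolding d_def using bdd that by (rule cINF_lower)
  have d0: "0 \<le> d" unfolding d_def using ne by (intro cINF_greatest) auto
  have "\<exists>h\<in>X. norm (f - h) < d + 1 / Suc n" for n
    using cINF_less_iff[OF ne bdd, of "d + 1 / Suc n"] by (simp add: d_def)
  then obtain g where gX: "\<And>n. g n \<in> X" and g: "\<And>n. norm (f - g n) < d + 1 / Suc n"
    by metis
  have lim: "(\<lambda>n. norm (f - g n)) \<longlonglongrightarrow> d"
  proof (rule tendsto_sandwich[OF _ _ tendsto_const])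
    show "(\<lambda>n. d + 1 / Suc n) \<longlonglongrightarrow> d"
      using LIMSEQ_inverse_real_of_nat_add[of d] by (simp add: inverse_eq_divide)
    show "\<forall>\<^sub>F n in sequentially. d \<le> norm (f - g n)"
      using d gX by simp
    show "\<forall>\<^sub>F n in sequentially. norm (f - g n) \<le> d + 1 / Suc n"
      using g by (intro always_eventually allI less_imp_le)
  qed
  have par: "(norm (g m - g n))\<^sup>2 \<le> 2 * (norm (f - g m))\<^sup>2 + 2 * (norm (f - g n))\<^sup>2 - 4 * d\<^sup>2" for m n
  proof -
    have mid: "(1/2) *\<^sub>R (g m + g n) \<in> X"
      using X gX closed_csubspace_scaleR[OF X] by (simp add: closed_csubspace_def)
    have "(2 * d)\<^sup>2 \<le> (2 * norm (f - (1/2) *\<^sub>R (g m + g n)))\<^sup>2"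
      using d[OF mid] d0 by (intro power_mono) auto
    also have "2 * norm (f - (1/2) *\<^sub>R (g m + g n)) = norm ((f - g m) + (f - g n))"
    proof -
      have "(f - g m) + (f - g n) = 2 *\<^sub>R (f - (1/2) *\<^sub>R (g m + g n))"
        by (simp add: algebra_simps scaleR_2)
      then show ?thesis by simp
    qed
    finally have "4 * d\<^sup>2 \<le> (norm ((f - g m) + (f - g n)))\<^sup>2"
      by (simp add: power_mult_distrib)
    moreover have "(norm (a + b))\<^sup>2 + (norm (b - a))\<^sup>2 = 2 * (norm a)\<^sup>2 + 2 * (norm b)\<^sup>2" for a b :: L2
      unfolding power2_norm_eq_inner by (simp add: inner_add inner_diff inner_commute)
    from this[of "f - g m" "f - g n"]
    have "(norm ((f - g m) + (f - g n)))\<^sup>2 + (norm (g m - g n))\<^sup>2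
        = 2 * (norm (f - g m))\<^sup>2 + 2 * (norm (f - g n))\<^sup>2"
      by simp
    ultimately show ?thesis by linarith
  qed
  have "Cauchy g"
  proof (rule CauchyI)
    fix e :: real assume e: "0 < e"
    have "(\<lambda>n. (norm (f - g n))\<^sup>2) \<longlonglongrightarrow> d\<^sup>2" using lim by (intro tendsto_intros)
    then have "\<forall>\<^sub>F n in sequentially. (norm (f - g n))\<^sup>2 < d\<^sup>2 + e\<^sup>2 / 4"
      using e by (intro order_tendstoD) auto
    then obtain N where N: "\<And>n. n \<ge> N \<Longrightarrow> (norm (f - g n))\<^sup>2 < d\<^sup>2 + e\<^sup>2 / 4"
      by (auto simp: eventually_sequentially)
    have "norm (g m - g n) < e" if "m \<ge> N" "n \<ge> N" for m n
    proof -
      have "(norm (g m - g n))\<^sup>2 < e\<^sup>2"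
        using par[of m n] N[OF that(1)] N[OF that(2)] by simp
      then show ?thesis using e by (simp add: power2_less_imp_less)
    qed
    then show "\<exists>M. \<forall>m\<ge>M. \<forall>n\<ge>M. norm (g m - g n) < e" by blast
  qed
  then obtain l where l: "g \<longlonglongrightarrow> l" by (auto simp: Cauchy_convergent_iff convergent_def)
  have "l \<in> X"
    using X gX l unfolding closed_csubspace_def by (meson closed_sequentially)
  moreover have "norm (f - l) = d"
    using lim by (rule LIMSEQ_unique[rotated]) (intro tendsto_intros l)
  ultimately show ?thesis using d that by auto
qed

text \<open>Moving the closest point along \<open>h\<close> by the step \<open>t\<close> that minimizes the distance would lower the
  squared distance by \<open>(inner (f - g) h)\<^sup>2 / inner h h\<close>; since it cannot be lowered, this inner product
  vanishes.\<close>

lemma closest_point_orthogonal: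
  assumes X: "closed_csubspace X" and g: "g \<in> X"
    and min: "\<And>h. h \<in> X \<Longrightarrow> norm (f - g) \<le> norm (f - h)"
  shows "f - g \<in> orth_comp X"
proof -
  have 1: "inner (f - g) h = 0" if h: "h \<in> X" for h
  proof (cases "h = 0")
    case False
    define t where "t = inner (f - g) h / inner h h"
    have pos: "inner h h > 0" using False by simp
    have "g + t *\<^sub>R h \<in> X"
      using X g closed_csubspace_scaleR[OF X h] by (simp add: closed_csubspace_def)
    then have "(norm (f - g))\<^sup>2 \<le> (norm (f - (g + t *\<^sub>R h)))\<^sup>2"
      by (intro power_mono min) auto
    also have "\<dots> = (norm (f - g))\<^sup>2 - 2 * t * inner (f - g) h + t\<^sup>2 * inner h h"
    proof -
      have "(norm (a - t *\<^sub>R h))\<^sup>2 = (norm a)\<^sup>2 - 2 * t * inner a h + t\<^sup>2 * inner h h" for a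
        unfolding power2_norm_eq_inner
        by (simp add: inner_diff inner_commute power2_eq_square algebra_simps)
      then show ?thesis unfolding diff_diff_eq[symmetric] .
    qed
    also have "\<dots> = (norm (f - g))\<^sup>2 - (inner (f - g) h)\<^sup>2 / inner h h"
      using pos by (simp add: t_def field_simps power2_eq_square)
    finally have "(inner (f - g) h)\<^sup>2 / inner h h \<le> 0" by simp
    then show ?thesis using pos by (simp add: divide_le_0_iff)
  qed simp
  \<comment> \<open>The imaginary part is the case of \<open>\<i> *\<^sub>C h\<close>.\<close>
  show ?thesis
    using 1 X by (auto simp: orth_comp_def cinner_eq_inner complex_eq_iff closed_csubspace_def)
qed

text \<open>The characterization through which all projections below are computed: a decomposition
  into a vector of \<open>X\<close> and a vector orthogonal to \<open>X\<close> is unique.\<close>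

lemma orth_proj_eqI:
  assumes X: "closed_csubspace X" and g: "g \<in> X" "f - g \<in> orth_comp X"
  shows "orth_proj X f = g"
  unfolding orth_proj_def
proof (rule the_equality)
  fix h assume h: "h \<in> X \<and> f - h \<in> orth_comp X"
  have "h - g \<in> X" using closed_csubspace_diff[OF X] h g by auto
  moreover have "h - g \<in> orth_comp X"
    using closed_csubspace_diff[OF closed_csubspace_orth_comp g(2) conjunct2[OF h]] by simp
  ultimately have "cinner (h - g) (h - g) = 0" by (auto simp: orth_comp_def)
  then show "h = g" by (simp add: cinner_self_eq_0_iff)
qed (use g in auto)

lemma orth_proj_props:
  assumes X: "closed_csubspace X"
  shows "orth_proj X f \<in> X" "f - orth_proj X f \<in> orth_comp X"
proof -
  obtain g where g: "g \<in> X" "f - g \<in> orth_comp X"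
    by (metis closest_point_exists_L2[OF X] closest_point_orthogonal[OF X])
  with orth_proj_eqI[OF X g] show "orth_proj X f \<in> X" "f - orth_proj X f \<in> orth_comp X"
    by auto
qed

section \<open>Completeness of the trigonometric system\<close>

lemma integral_circle:
  fixes f :: "complex \<Rightarrow> complex"
  assumes f: "continuous_on UNIV (\<lambda>t. f (cis t))" and m: "f \<in> borel_measurable circle"
  shows "(\<integral>z. f z \<partial>circle) = (1 / (2 * pi)) *\<^sub>R integral {0..2*pi} (\<lambda>t. f (cis t))"
proof -
  have d: "uniform_measure lborel {0..2*pi}
      = density lborel (\<lambda>t. ennreal (indicator {0..2*pi} t / (2*pi)))"
    unfolding uniform_measure_def
    by (intro arg_cong[of _ _ "density lborel"] ext)
      (auto simp: divide_ennreal indicator_def ennreal_1[symmetric] simp del: ennreal_1)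
  have [measurable]: "f \<in> borel_measurable (restrict_space borel (sphere 0 1))"
    using m by (simp add: circle_def)
  have meas: "(\<lambda>t. f (cis t)) \<in> borel_measurable lborel"
    using borel_measurable_continuous_onI[OF f] by simp
  have "(\<integral>z. f z \<partial>circle) = (\<integral>t. f (cis t) \<partial>uniform_measure lborel {0..2*pi})"
    unfolding circle_def by (rule integral_distr[OF measurable_cis_circle]) simp
  also have "\<dots> = (\<integral>t. (indicator {0..2*pi} t / (2*pi)) *\<^sub>R f (cis t) \<partial>lborel)"
    unfolding d by (rule integral_density[OF meas]) auto
  also have "\<dots> = (\<integral>t. (1 / (2*pi)) *\<^sub>R (indicator {0..2*pi} t *\<^sub>R f (cis t)) \<partial>lborel)"
    by (intro Bochner_Integration.integral_cong) (auto simp: indicator_def)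
  also have "\<dots> = (1 / (2*pi)) *\<^sub>R (\<integral>t. indicator {0..2*pi} t *\<^sub>R f (cis t) \<partial>lborel)"
    by (rule integral_scaleR_right)
  also have "(\<integral>t. indicator {0..2*pi} t *\<^sub>R f (cis t) \<partial>lborel) = integral {0..2*pi} (\<lambda>t. f (cis t))"
    using set_borel_integral_eq_integral(2)[of "{0..2*pi}" "\<lambda>t. f (cis t)"]
      borel_integrable_atLeastAtMost'[of 0 "2*pi" "\<lambda>t. f (cis t)"] continuous_on_subset[OF f]
    by (simp add: set_lebesgue_integral_def)
  finally show ?thesis .
qed

lemma borel_measurable_powi_circle [measurable]: "(\<lambda>z. z powi k) \<in> borel_measurable circle"
  using square_int_powi by (rule square_int_measurable)

lemma integral_powi_circle:
  assumes "k \<noteq> 0"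
  shows "(\<integral>z. z powi k \<partial>circle) = 0"
proof -
  have cis: "cis t powi k = exp (of_int k * \<i> * of_real t)" for t
    unfolding cis_power_int by (simp add: cis_conv_exp mult_ac)
  have "((\<lambda>t. exp (of_int k * \<i> * of_real t) / (of_int k * \<i>))
      has_vector_derivative exp (of_int k * \<i> * of_real t)) (at t within {0..2*pi})" for t
    using assms
    by (intro has_vector_derivative_real_field[where f = "\<lambda>w. exp (of_int k * \<i> * w) / (of_int k * \<i>)"])
      (auto intro!: derivative_eq_intros)
  then have "((\<lambda>t. exp (of_int k * \<i> * of_real t)) has_integral
      exp (of_int k * \<i> * of_real (2*pi)) / (of_int k * \<i>) - exp (of_int k * \<i> * of_real 0) / (of_int k * \<i>)) {0..2*pi}"
    by (intro fundamental_theorem_of_calculus) auto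
  moreover have "exp (of_int k * \<i> * of_real (2*pi)) = 1"
    using exp_2pi_1_int[of k] by (simp add: mult_ac)
  ultimately have "integral {0..2*pi} (\<lambda>t. cis t powi k) = 0"
    unfolding cis by (auto intro: integral_unique)
  then show ?thesis
    by (subst integral_circle) (auto simp: cis intro!: continuous_intros)
qed

lemma cnj_powi_circle: "z \<in> sphere 0 1 \<Longrightarrow> cnj (z powi k) = z powi (-k)"
proof -
  assume "z \<in> sphere 0 1"
  then have "z * cnj z = 1" by (simp add: complex_norm_square[symmetric])
  then have "cnj z = inverse z" by (metis inverse_unique)
  then show ?thesis by (simp add: power_int_minus power_int_inverse)
qed

lemma L2_rel_powi: "L2_rel (\<lambda>z. z powi n) (\<lambda>z. z powi n)"
  by (simp add: L2_rel_def square_int_powi)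

lemma fourier_coeff_monomial:
  assumes "m \<noteq> n"
  shows "fourier_coeff (monomial m) n = 0"
proof -
  have "fourier_coeff (monomial m) n = (\<integral>z. z powi m * cnj (z powi n) \<partial>circle)"
    unfolding fourier_coeff_def by transfer simp
  also have "\<dots> = (\<integral>z. z powi (m - n) \<partial>circle)"
  proof (rule Bochner_Integration.integral_cong)
    fix z assume z: "z \<in> space circle"
    then have "z \<noteq> 0" by (auto simp: space_circle)
    then show "z powi m * cnj (z powi n) = z powi (m - n)"
      using z by (simp add: space_circle cnj_powi_circle del: complex_cnj_power_int flip: power_int_add)
  qed simp
  finally show ?thesis using assms by (simp add: integral_powi_circle)
qed

text \<open>The functions orthogonal to every monomial. All integer exponents occur, and on the circle
  the conjugate of a monomial is the one with opposite exponent, so the conjugation in the inner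
  product can be dropped. Working with functions rather than with elements
  of \<^typ>\<open>L2\<close> allows multiplication by arbitrary indicators and continuous functions.\<close>

definition fourier_null :: "(complex \<Rightarrow> complex) \<Rightarrow> bool" where
  "fourier_null f \<longleftrightarrow> square_int f \<and> (\<forall>n. (\<integral>z. f z * z powi n \<partial>circle) = 0)"

lemma integrable_square_int_powi: "square_int f \<Longrightarrow> integrable circle (\<lambda>z. f z * z powi n)"
proof -
  assume f: "square_int f"
  have "integrable circle (\<lambda>z. f z * cnj (z powi (-n)))"
    by (rule square_int_mult_integrable[OF f square_int_powi])
  then show ?thesis
    by (rule iffD1[OF Bochner_Integration.integrable_cong, rotated 2])
      (auto simp: space_circle cnj_powi_circle simp del: complex_cnj_power_int)
qed

lemma fourier_null_mult_powi:
  assumes "fourier_null f" shows "fourier_null (\<lambda>z. z powi k * f z)"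
proof -
  have "ess_bounded (\<lambda>z. z powi k)"
    unfolding ess_bounded_def by (auto intro!: AE_I2 exI[of _ 1] simp: space_circle norm_power_int)
  then have "square_int (\<lambda>z. z powi k * f z)"
    using assms by (intro square_int_ess_bounded_mult) (auto simp: fourier_null_def)
  moreover have "(\<integral>z. z powi k * f z * z powi n \<partial>circle) = (\<integral>z. f z * z powi (k + n) \<partial>circle)" for n
  proof (rule Bochner_Integration.integral_cong)
    fix z assume "z \<in> space circle"
    then have "z \<noteq> 0" by (auto simp: space_circle)
    then show "z powi k * f z * z powi n = f z * z powi (k + n)" by (simp add: power_int_add)
  qed simp
  ultimately show ?thesis using assms by (simp add: fourier_null_def)
qed

lemma fourier_null_scale: "fourier_null f \<Longrightarrow> fourier_null (\<lambda>z. c * f z)"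
  by (simp add: fourier_null_def square_int_scale mult.assoc)

lemma fourier_null_add: "fourier_null f \<Longrightarrow> fourier_null g \<Longrightarrow> fourier_null (\<lambda>z. f z + g z)"
  by (simp add: fourier_null_def square_int_add distrib_right integrable_square_int_powi)

lemma square_int_cong:
  assumes "\<And>z. z \<in> sphere 0 1 \<Longrightarrow> f z = g z"
  shows "square_int f \<longleftrightarrow> square_int g"
proof -
  have "f \<in> borel_measurable circle \<longleftrightarrow> g \<in> borel_measurable circle"
    by (rule measurable_cong) (simp add: assms space_circle)
  moreover have "integrable circle (\<lambda>z. (cmod (f z))\<^sup>2) \<longleftrightarrow> integrable circle (\<lambda>z. (cmod (g z))\<^sup>2)"
    by (rule Bochner_Integration.integrable_cong) (simp_all add: assms space_circle)
  ultimately show ?thesis by (simp add: square_int_def)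
qed

lemma fourier_null_cong:
  assumes "\<And>z. z \<in> sphere 0 1 \<Longrightarrow> f z = g z"
  shows "fourier_null f \<longleftrightarrow> fourier_null g"
proof -
  have "(\<integral>z. f z * z powi n \<partial>circle) = (\<integral>z. g z * z powi n \<partial>circle)" for n
    by (rule Bochner_Integration.integral_cong) (simp_all add: assms space_circle)
  moreover have "square_int f \<longleftrightarrow> square_int g" using assms by (rule square_int_cong)
  ultimately show ?thesis by (simp add: fourier_null_def)
qed

text \<open>Multiplication by \<open>z\<close> or by \<open>cnj z = 1/z\<close> only shifts the Fourier coefficients. A real linear form
  on the plane is \<open>c * z + cnj c * cnj z\<close>, so it preserves the property, and products of polynomials
  act by composition. Generalizing over \<open>f\<close> is what makes the product case immediate.\<close>

lemma fourier_null_mult_polynomial: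
  assumes "real_polynomial_function p" "fourier_null f"
  shows "fourier_null (\<lambda>z. complex_of_real (p z) * f z)"
  using assms
proof (induction p arbitrary: f rule: real_polynomial_function.induct)
  case (linear l)
  define c where "c = (complex_of_real (l 1) - \<i> * complex_of_real (l \<i>)) / 2"
  interpret l: bounded_linear l by (rule linear)
  have l: "complex_of_real (l z) = c * z + cnj c * cnj z" for z
  proof -
    have "l z = l (Re z *\<^sub>R 1 + Im z *\<^sub>R \<i>)"
      by (rule arg_cong[of _ _ l]) (simp add: complex_eq_iff)
    also have "\<dots> = Re z * l 1 + Im z * l \<i>" by (simp add: l.add l.scaleR)
    finally show ?thesis by (simp add: c_def complex_eq_iff field_simps)
  qed
  have "fourier_null (\<lambda>z. c * (z powi 1 * f z) + cnj c * (z powi (-1) * f z))"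
    by (intro fourier_null_add fourier_null_scale fourier_null_mult_powi linear)
  also have "?this \<longleftrightarrow> fourier_null (\<lambda>z. complex_of_real (l z) * f z)"
  proof (rule fourier_null_cong)
    fix z :: complex assume "z \<in> sphere 0 1"
    then have "cnj z = z powi (-1)" using cnj_powi_circle[of z 1] by simp
    then show "c * (z powi 1 * f z) + cnj c * (z powi (-1) * f z) = complex_of_real (l z) * f z"
      by (simp add: l algebra_simps)
  qed
  finally show ?case .
next
  case (const c)
  then show ?case by (rule fourier_null_scale)
next
  case (add p q)
  then show ?case using fourier_null_add[OF add.IH(1) add.IH(2)] by (simp add: distrib_right)
next
  case (mult p q)
  show ?case using mult.IH(1)[OF mult.IH(2)[OF mult.prems]] by (simp add: mult.assoc)
qed

lemma fourier_null_integrable: "fourier_null f \<Longrightarrow> integrable circle f"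
  using integrable_square_int_powi[of f 0] by (simp add: fourier_null_def)

text \<open>By Stone--Weierstrass, \<open>g\<close> is a uniform limit on the circle of real polynomials in the two
  coordinates, against which \<open>f\<close> integrates to 0.\<close>

lemma fourier_null_integral_continuous:
  fixes g :: "complex \<Rightarrow> real"
  assumes f: "fourier_null f" and g: "continuous_on UNIV g"
  shows "(\<integral>z. complex_of_real (g z) * f z \<partial>circle) = 0"
proof -
  define I where "I = (\<integral>z. cmod (f z) \<partial>circle)"
  note fi = fourier_null_integrable[OF f]
  have I: "0 \<le> I" by (simp add: I_def)
  have gi: "integrable circle (\<lambda>z. complex_of_real (h z) * f z)"
    if h: "continuous_on UNIV h" for h :: "complex \<Rightarrow> real"
  proof -
    have "bounded (h ` sphere 0 1)"
      by (intro compact_imp_bounded compact_continuous_image continuous_on_subset[OF h]) auto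
    then obtain B where B: "\<And>z. cmod z = 1 \<Longrightarrow> \<bar>h z\<bar> \<le> B" unfolding bounded_iff by force
    have hm [measurable]: "h \<in> borel_measurable circle"
      using borel_measurable_circle[OF borel_measurable_continuous_onI] h
      unfolding circle_def by (auto intro!: measurable_restrict_space1 borel_measurable_continuous_onI)
    have [measurable]: "f \<in> borel_measurable circle" using fi by simp
    show ?thesis
    proof (rule Bochner_Integration.integrable_bound)
      show "integrable circle (\<lambda>z. B * cmod (f z))" using fi by simp
      show "AE z in circle. norm (complex_of_real (h z) * f z) \<le> norm (B * cmod (f z))"
      proof (rule AE_I2)
        fix z assume "z \<in> space circle"
        then have "\<bar>h z\<bar> \<le> \<bar>B\<bar>" using B[of z] by (auto simp: space_circle)
        then show "norm (complex_of_real (h z) * f z) \<le> norm (B * cmod (f z))"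
          by (simp add: norm_mult abs_mult mult_right_mono)
      qed
    qed measurable
  qed
  have bound: "cmod (\<integral>z. complex_of_real (g z) * f z \<partial>circle) \<le> e * I" if e: "e > 0" for e
  proof -
    obtain p where p: "real_polynomial_function p" "\<And>z. z \<in> sphere 0 1 \<Longrightarrow> \<bar>g z - p z\<bar> < e"
      using Stone_Weierstrass_real_polynomial_function[OF compact_sphere continuous_on_subset[OF g] e]
      by (metis subset_UNIV)
    have pc: "continuous_on UNIV p"
      using p(1) by (simp add: real_polynomial_function_eq continuous_on_polymonial_function)
    have "(\<integral>z. complex_of_real (p z) * f z \<partial>circle) = 0"
      using fourier_null_mult_polynomial[OF p(1) f]
      by (auto simp: fourier_null_def dest!: spec[of _ 0])
    then have "(\<integral>z. complex_of_real (g z) * f z \<partial>circle)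
        = (\<integral>z. complex_of_real (g z) * f z - complex_of_real (p z) * f z \<partial>circle)"
      using gi[OF g] gi[OF pc] by simp
    also have "cmod \<dots> \<le> (\<integral>z. e * cmod (f z) \<partial>circle)"
    proof (rule Bochner_Integration.integral_norm_bound_integral)
      fix z assume "z \<in> space circle"
      then have "\<bar>g z - p z\<bar> \<le> e" using p(2)[of z] by (simp add: space_circle)
      then show "cmod (complex_of_real (g z) * f z - complex_of_real (p z) * f z) \<le> e * cmod (f z)"
        unfolding left_diff_distrib[symmetric] of_real_diff[symmetric] norm_mult norm_of_real
        by (rule mult_right_mono) simp
    qed (use gi[OF g] gi[OF pc] fi in auto)
    finally show ?thesis by (simp add: I_def)
  qed
  have "cmod (\<integral>z. complex_of_real (g z) * f z \<partial>circle) \<le> e" if e: "e > 0" for e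
  proof -
    \<comment> \<open>The denominator is \<open>I + 1\<close> because \<open>I\<close> may vanish.\<close>
    have "cmod (\<integral>z. complex_of_real (g z) * f z \<partial>circle) \<le> e / (I + 1) * I"
      using e I by (intro bound) simp
    also have "\<dots> \<le> e" using e I by (simp add: field_simps)
    finally show ?thesis .
  qed
  then have "cmod (\<integral>z. complex_of_real (g z) * f z \<partial>circle) \<le> 0"
    by (rule field_le_epsilon[of _ 0, simplified])
  then show ?thesis by simp
qed

text \<open>The indicator of \<open>C\<close> is the pointwise limit of the continuous functions
  \<open>1 / (1 + k * infdist z C)\<close>, which are bounded by 1; dominated convergence applies.\<close>

lemma fourier_null_integral_closed:
  assumes f: "fourier_null f" and C: "closed C"
  shows "(\<integral>z. indicat_real C z *\<^sub>R f z \<partial>circle) = 0"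
proof (cases "C = {}")
  case False
  note fi = fourier_null_integrable[OF f]
  have [measurable]: "f \<in> borel_measurable circle" using fi by simp
  define g where "g k z = 1 / (1 + real k * infdist z C)" for k :: nat and z
  have pos: "1 + real k * infdist z C > 0" for k z
    using infdist_nonneg[of z C] by (simp add: add_pos_nonneg)
  have gc: "continuous_on UNIV (g k)" for k
    unfolding g_def using pos by (intro continuous_intros) (metis less_irrefl)
  have [measurable]: "g k \<in> borel_measurable circle" for k
    using gc unfolding circle_def by (auto intro!: measurable_restrict_space1 borel_measurable_continuous_onI)
  have [measurable]: "indicat_real C \<in> borel_measurable circle"
    unfolding circle_def using C by (auto intro!: measurable_restrict_space1)
  have g1: "\<bar>g k z\<bar> \<le> 1" for k z
    using infdist_nonneg[of z C] pos[of k z] by (simp add: g_def field_simps)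
  have lim: "(\<lambda>k. g k z) \<longlonglongrightarrow> indicat_real C z" for z
  proof (cases "z \<in> C")
    case True
    then show ?thesis by (simp add: g_def)
  next
    case z: False
    then have "infdist z C > 0"
      using in_closed_iff_infdist_zero[OF C False] infdist_nonneg[of z C] by force
    then have "(\<lambda>k. g k z) \<longlonglongrightarrow> 0" unfolding g_def by real_asymp
    then show ?thesis using z by simp
  qed
  have "(\<lambda>k. \<integral>z. g k z *\<^sub>R f z \<partial>circle) \<longlonglongrightarrow> (\<integral>z. indicat_real C z *\<^sub>R f z \<partial>circle)"
  proof (rule integral_dominated_convergence[where w = "\<lambda>z. cmod (f z)"])
    show "integrable circle (\<lambda>z. cmod (f z))" using fi by simp
    show "AE z in circle. (\<lambda>k. g k z *\<^sub>R f z) \<longlonglongrightarrow> indicat_real C z *\<^sub>R f z"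
      by (intro AE_I2 tendsto_intros lim)
    show "AE z in circle. norm (g k z *\<^sub>R f z) \<le> cmod (f z)" for k
      using g1 by (intro AE_I2) (simp add: mult_left_le_one_le)
  qed measurable
  moreover have "(\<integral>z. g k z *\<^sub>R f z \<partial>circle) = 0" for k
    using fourier_null_integral_continuous[OF f gc] by (simp add: scaleR_conv_of_real)
  ultimately show ?thesis by (simp add: LIMSEQ_const_iff)
qed simp

text \<open>Closed sets form an intersection-stable generator of the Borel sets, so the integral of \<open>f\<close> over
  every Borel set vanishes, and with it \<open>f\<close>.\<close>

lemma fourier_null_AE:
  assumes f: "fourier_null f"
  shows "AE z in circle. f z = 0"
proof -
  interpret finite_measure circle by (rule finite_measure_circle)
  note fi = fourier_null_integrable[OF f]
  have sets: "A \<inter> sphere 0 1 \<in> sets circle" if "A \<in> sets borel" for A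
    using that by (auto simp: circle_def sets_restrict_space)
  have ii: "integrable circle (\<lambda>z. indicat_real A z *\<^sub>R f z)" if "A \<in> sets borel" for A
  proof -
    have "integrable circle (\<lambda>z. indicat_real (A \<inter> sphere 0 1) z *\<^sub>R f z)"
      by (rule integrable_mult_indicator[OF sets[OF that] fi])
    then show ?thesis
      by (rule iffD1[OF Bochner_Integration.integrable_cong, rotated 2])
        (auto simp: space_circle indicator_def)
  qed
  have 0: "(\<integral>z. indicat_real A z *\<^sub>R f z \<partial>circle) = 0" if A: "A \<in> sets borel" for A
  proof -
    have "Int_stable (Collect closed :: complex set set)" "Collect closed \<subseteq> Pow (UNIV :: complex set)"
      "A \<in> sigma_sets UNIV (Collect closed)"
      using A by (auto simp: Int_stable_def borel_eq_closed)
    then show ?thesis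
    proof (induct A rule: sigma_sets_induct_disjoint)
      case (basic A)
      then show ?case using fourier_null_integral_closed[OF f] by simp
    next
      case (compl A)
      then have A: "A \<in> sets borel" by (simp add: borel_eq_closed)
      have "(\<integral>z. indicat_real (UNIV - A) z *\<^sub>R f z \<partial>circle)
          = (\<integral>z. f z - indicat_real A z *\<^sub>R f z \<partial>circle)"
        by (intro Bochner_Integration.integral_cong) (auto simp: indicator_def)
      also have "\<dots> = (\<integral>z. f z \<partial>circle)"
        using fi ii[OF A] compl(2) by simp
      also have "\<dots> = 0"
        using fourier_null_integral_closed[OF f closed_UNIV] by simp
      finally show ?case .
    next
      case (union A)
      then have A: "A i \<in> sets borel" for i by (auto simp: borel_eq_closed)
      define S where "S i = A i \<inter> sphere 0 1" for i
      have S: "S i \<in> sets circle" for i unfolding S_def by (rule sets[OF A])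
      have eq: "(LINT z:S i|circle. f z) = (\<integral>z. indicat_real (A i) z *\<^sub>R f z \<partial>circle)" for i
        unfolding set_lebesgue_integral_def S_def
        by (intro Bochner_Integration.integral_cong) (auto simp: indicator_def space_circle)
      have "(\<integral>z. indicat_real (\<Union>i. A i) z *\<^sub>R f z \<partial>circle) = (LINT z:(\<Union>i. S i)|circle. f z)"
        unfolding set_lebesgue_integral_def S_def
        by (intro Bochner_Integration.integral_cong) (auto simp: indicator_def space_circle)
      also have "\<dots> = (\<Sum>i. LINT z:S i|circle. f z)"
      proof (rule lebesgue_integral_countable_add[OF S])
        show "S i \<inter> S j = {}" if "i \<noteq> j" for i j
          using union(1) that by (auto simp: S_def disjoint_family_on_def)
        show "set_integrable circle (\<Union>i. S i) f"
          unfolding set_integrable_def using S fi by (intro integrable_mult_indicator) auto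
      qed
      finally show ?case by (simp add: eq union(3))
    qed simp
  qed
  show ?thesis
  proof (rule density_zero[OF fi])
    fix A assume "A \<in> sets circle"
    then have "A \<in> sets borel"
      by (auto simp: circle_def sets_restrict_space)
    then show "(LINT z:A|circle. f z) = 0"
      unfolding set_lebesgue_integral_def by (rule 0)
  qed
qed

lemma L2_eq_0_if_fourier_coeffs_0:
  assumes "\<And>n. fourier_coeff f n = 0"
  shows "f = 0"
proof -
  obtain F where F: "square_int F" "f = abs_L2 F" by (rule L2_cases)
  have rel: "L2_rel F F" using F by (simp add: L2_rel_def)
  have "(\<integral>z. F z * z powi n \<partial>circle) = 0" for n
  proof -
    have "fourier_coeff f (-n) = (\<integral>z. F z * cnj (z powi (-n)) \<partial>circle)"
      by (simp add: fourier_coeff_def F(2) cinner.abs_eq[OF rel L2_rel_powi] monomial_def)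
    also have "\<dots> = (\<integral>z. F z * z powi n \<partial>circle)"
      by (intro Bochner_Integration.integral_cong)
        (auto simp: space_circle cnj_powi_circle simp del: complex_cnj_power_int)
    finally show ?thesis using assms by simp
  qed
  then have "AE z in circle. F z = 0"
    using F by (intro fourier_null_AE) (simp add: fourier_null_def)
  then have "L2_rel F (\<lambda>z. 0)" using F by (simp add: L2_rel_def square_int_0)
  then show ?thesis
    unfolding F(2) zero_L2_def by (rule Quotient3_rel_abs[OF Quotient3_L2])
qed

section \<open>The projections of the Hardy decomposition\<close>

lemma P_plus_in_H2: "P_plus f \<in> H2"
  unfolding P_plus_def by (rule orth_proj_props(1)[OF closed_csubspace_H2])

lemma P_minus_in_orth_comp: "P_minus f \<in> orth_comp H2"
  unfolding P_minus_def P_plus_def by (rule orth_proj_props(2)[OF closed_csubspace_H2])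

lemma P_plus_eqI: "g \<in> H2 \<Longrightarrow> f - g \<in> orth_comp H2 \<Longrightarrow> P_plus f = g"
  unfolding P_plus_def by (rule orth_proj_eqI[OF closed_csubspace_H2])

lemma P_plus_add_P_minus: "P_plus f + P_minus f = f"
  by (simp add: P_minus_def)

lemma P_minus_add_P_plus: "P_minus f + P_plus f = f"
  by (simp add: P_minus_def)

lemma P_plus_add: "P_plus (f + g) = P_plus f + P_plus g"
proof (rule P_plus_eqI)
  show "P_plus f + P_plus g \<in> H2"
    using closed_csubspace_H2 P_plus_in_H2 by (auto simp: closed_csubspace_def)
  have "P_minus f + P_minus g \<in> orth_comp H2"
    using closed_csubspace_orth_comp[of H2] P_minus_in_orth_comp by (auto simp: closed_csubspace_def)
  then show "f + g - (P_plus f + P_plus g) \<in> orth_comp H2"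
    by (simp add: P_minus_def algebra_simps)
qed

lemma scaleC_diff_right: "c *\<^sub>C (x - y) = c *\<^sub>C x - c *\<^sub>C (y :: 'a::complex_banach)"
  using scaleC_add_right[of c "x - y" y] by simp

lemma P_plus_scaleC: "P_plus (c *\<^sub>C f) = c *\<^sub>C P_plus f"
proof (rule P_plus_eqI)
  show "c *\<^sub>C P_plus f \<in> H2"
    using closed_csubspace_H2 P_plus_in_H2 by (auto simp: closed_csubspace_def)
  have "c *\<^sub>C P_minus f \<in> orth_comp H2"
    using closed_csubspace_orth_comp[of H2] P_minus_in_orth_comp by (auto simp: closed_csubspace_def)
  then show "c *\<^sub>C f - c *\<^sub>C P_plus f \<in> orth_comp H2"
    by (simp add: P_minus_def scaleC_diff_right)
qed

lemma P_plus_H2 [simp]: "f \<in> H2 \<Longrightarrow> P_plus f = f"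
  using closed_csubspace_orth_comp[of H2] by (intro P_plus_eqI) (auto simp: closed_csubspace_def)

lemma P_plus_orth_comp_H2 [simp]: "f \<in> orth_comp H2 \<Longrightarrow> P_plus f = 0"
  using closed_csubspace_H2 by (intro P_plus_eqI) (auto simp: closed_csubspace_def)

lemma P_plus_diff: "P_plus (f - g) = P_plus f - P_plus g"
  using P_plus_add[of "f - g" g] by simp

lemma P_plus_uminus: "P_plus (- f) = - P_plus f"
  using P_plus_diff[of 0 f] P_plus_diff[of 0 0] by simp

lemma P_plus_idem [simp]: "P_plus (P_plus f) = P_plus f"
  by (simp add: P_plus_in_H2)

lemma P_plus_P_minus [simp]: "P_plus (P_minus f) = 0"
  by (simp add: P_minus_in_orth_comp)

lemma norm_P_plus_le: "norm (P_plus f) \<le> norm f"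
proof -
  have "cinner (P_minus f) (P_plus f) = 0"
    using P_minus_in_orth_comp[of f] P_plus_in_H2[of f] by (auto simp: orth_comp_def)
  then have "inner (P_plus f) (P_minus f) = 0"
    by (subst inner_commute) (simp add: inner_L2_def)
  then have "(norm f)\<^sup>2 = (norm (P_plus f))\<^sup>2 + (norm (P_minus f))\<^sup>2"
    using norm_add_Pythagorean[of "P_plus f" "P_minus f"]
    by (simp add: orthogonal_def P_plus_add_P_minus)
  then show ?thesis by (intro power2_le_imp_le[of "norm (P_plus f)"]) auto
qed

lemma P_minus_simps:
  "P_minus (f + g) = P_minus f + P_minus g"
  "P_minus (f - g) = P_minus f - P_minus g"
  "P_minus (- f) = - P_minus f"
  "P_minus (P_minus f) = P_minus f"
  "f \<in> H2 \<Longrightarrow> P_minus f = 0"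
  "f \<in> orth_comp H2 \<Longrightarrow> P_minus f = f"
  by (simp_all add: P_minus_def P_plus_add P_plus_diff P_plus_uminus)

section \<open>Multiplication by bounded functions\<close>

lemma Linf_mult_assoc: "a \<odot> b \<odot> f = (a * b) \<odot> f"
  by transfer (auto simp: Linf_rel_def L2_rel_def mult.assoc intro!: square_int_ess_bounded_mult)

lemma Linf_mult_one [simp]: "1 \<odot> f = f"
  by transfer (auto simp: L2_rel_def)

lemma Linf_mult_add: "a \<odot> (f + g) = a \<odot> f + a \<odot> g"
  by transfer (auto simp: Linf_rel_def L2_rel_def distrib_left
      intro!: square_int_ess_bounded_mult square_int_add)

lemma Linf_mult_scaleC: "a \<odot> (c *\<^sub>C f) = c *\<^sub>C (a \<odot> f)"
  by transfer (auto simp: Linf_rel_def L2_rel_def mult_ac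
      intro!: square_int_ess_bounded_mult square_int_scale)

lemma Linf_mult_diff: "a \<odot> (f - g) = a \<odot> f - a \<odot> g"
  using Linf_mult_add[of a "f - g" g] by simp

lemma Linf_zero_mult [simp]: "0 \<odot> f = 0"
  by transfer (auto simp: L2_rel_def square_int_0)

lemma Linf_uminus_mult: "(- a) \<odot> f = - (a \<odot> f)"
  by transfer (auto simp: Linf_rel_def L2_rel_def intro!: square_int_uminus square_int_ess_bounded_mult)

lemma Linf_mult_bounded: "\<exists>C. \<forall>f. norm (a \<odot> f) \<le> C * norm f"
proof -
  obtain F where F: "Linf_rel F F" "a = abs_Linf F"
    by (metis Quotient3_rep_reflp[OF Quotient3_Linf] Quotient3_abs_rep[OF Quotient3_Linf])
  then have eF: "ess_bounded F" by (simp add: Linf_rel_def)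
  then obtain C where C: "AE z in circle. cmod (F z) \<le> C" by (auto simp: ess_bounded_def)
  have "norm (a \<odot> f) \<le> \<bar>C\<bar> * norm f" for f
  proof -
    obtain G where G: "square_int G" "f = abs_L2 G" by (rule L2_cases)
    then have rel: "L2_rel G G" by (simp add: L2_rel_def)
    have FG: "square_int (\<lambda>z. F z * G z)" using eF G by (intro square_int_ess_bounded_mult)
    have "(\<integral>z. (cmod (F z * G z))\<^sup>2 \<partial>circle) \<le> (\<integral>z. \<bar>C\<bar>\<^sup>2 * (cmod (G z))\<^sup>2 \<partial>circle)"
    proof (rule integral_mono_AE)
      show "AE z in circle. (cmod (F z * G z))\<^sup>2 \<le> \<bar>C\<bar>\<^sup>2 * (cmod (G z))\<^sup>2"
        using C
      proof eventually_elim
        case (elim z)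
        then have "cmod (F z * G z) \<le> \<bar>C\<bar> * cmod (G z)"
          unfolding norm_mult by (intro mult_right_mono) auto
        then show ?case unfolding power_mult_distrib[symmetric] by (intro power_mono) auto
      qed
    qed (use FG G in \<open>auto simp: square_int_def\<close>)
    then have "sqrt (\<integral>z. (cmod (F z * G z))\<^sup>2 \<partial>circle) \<le> \<bar>C\<bar> * sqrt (\<integral>z. (cmod (G z))\<^sup>2 \<partial>circle)"
      by (metis abs_abs integral_mult_right_zero real_sqrt_abs real_sqrt_le_mono real_sqrt_mult)
    then show ?thesis
      using FG G by (simp add: F Linf_mult.abs_eq[OF F(1) rel] norm_abs_L2)
  qed
  then show ?thesis by blast
qed

lemma cinner_Linf_mult: "cinner (a \<odot> f) g = cinner f (Linf_cnj a \<odot> g)"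
  by transfer (simp add: mult_ac)

lemma Linf_cnj_cnj [simp]: "Linf_cnj (Linf_cnj a) = a"
  by transfer (simp add: Linf_rel_def)

lemma Linf_cnj_mult_self: "unimodular a \<Longrightarrow> Linf_cnj a * a = 1"
proof transfer
  fix a assume a: "Linf_rel a a" and 1: "AE z in circle. cmod (a z) = 1"
  from 1 have "AE z in circle. cnj (a z) * a z = 1"
    by eventually_elim (simp add: complex_norm_square[symmetric] mult.commute[of "cnj _"])
  then show "Linf_rel (\<lambda>z. cnj (a z) * a z) (\<lambda>z. 1)"
    using a by (simp add: Linf_rel_def ess_bounded_const ess_bounded_mult ess_bounded_cnj)
qed

section \<open>Inner functions and the Hardy space\<close>

lemma monomial_in_H2: "m \<ge> 0 \<Longrightarrow> monomial m \<in> H2"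
  by (auto simp: H2_def fourier_coeff_monomial)

text \<open>The space \<open>H2\<close> is defined by the vanishing of coefficients; that it is also the closed
  span of the monomials with nonnegative exponent depends on completeness. The coefficients of \<open>P_plus k\<close> vanish: the
  negative ones because it lies in \<open>H2\<close>, the others because they agree with those of \<open>k\<close>.\<close>

lemma orth_comp_H2I:
  assumes k: "\<And>m. m \<ge> 0 \<Longrightarrow> fourier_coeff k m = 0"
  shows "k \<in> orth_comp H2"
proof -
  have "P_plus k = 0"
  proof (rule L2_eq_0_if_fourier_coeffs_0)
    fix m
    show "fourier_coeff (P_plus k) m = 0"
    proof (cases "m \<ge> 0")
      case True
      then have "cinner (P_minus k) (monomial m) = 0"
        using P_minus_in_orth_comp[of k] monomial_in_H2 by (auto simp: orth_comp_def)
      then show ?thesis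
        using k[OF True] by (simp add: fourier_coeff_def P_minus_def cinner_diff_left)
    next
      case False
      then show ?thesis using P_plus_in_H2[of k] by (simp add: H2_def)
    qed
  qed
  then show ?thesis using P_minus_in_orth_comp[of k] by (simp add: P_minus_def)
qed

lemma fourier_coeff_mult_monomial:
  "fourier_coeff (a \<odot> monomial m) n = fourier_coeff (L2_of_Linf a) (n - m)"
  unfolding fourier_coeff_def
proof transfer
  fix a :: "complex \<Rightarrow> complex" and m n :: int
  show "(\<integral>z. a z * z powi m * cnj (z powi n) \<partial>circle) = (\<integral>z. a z * cnj (z powi (n - m)) \<partial>circle)"
  proof (rule Bochner_Integration.integral_cong)
    fix z assume z: "z \<in> space circle"
    then have "z \<noteq> 0" by (auto simp: space_circle)
    then show "a z * z powi m * cnj (z powi n) = a z * cnj (z powi (n - m))"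
      using z by (simp add: space_circle cnj_powi_circle del: complex_cnj_power_int flip: power_int_add)
  qed simp
qed

text \<open>The coefficient of \<open>\<alpha> \<odot> h\<close> at \<open>n < 0\<close> is the inner product of \<open>h\<close> with
  \<open>Linf_cnj \<alpha> \<odot> monomial n\<close>. The latter has only negative coefficients, since \<open>\<alpha>\<close> has only
  nonnegative ones, so it is orthogonal to \<open>H2\<close>.\<close>

lemma inner_function_mult_H2:
  assumes \<alpha>: "inner_function \<alpha>" and h: "h \<in> H2"
  shows "\<alpha> \<odot> h \<in> H2"
proof -
  have "fourier_coeff (\<alpha> \<odot> h) n = 0" if n: "n < 0" for n
  proof -
    have "Linf_cnj \<alpha> \<odot> monomial n \<in> orth_comp H2"
    proof (rule orth_comp_H2I)
      fix m :: int assume m: "0 \<le> m"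
      have "fourier_coeff (Linf_cnj \<alpha> \<odot> monomial n) m = cinner (monomial n) (\<alpha> \<odot> monomial m)"
        by (simp add: fourier_coeff_def cinner_Linf_mult)
      also have "\<dots> = cnj (fourier_coeff (\<alpha> \<odot> monomial m) n)"
        by (simp add: fourier_coeff_def cinner_commute[of "monomial n"])
      also have "\<dots> = 0"
        using \<alpha> n m by (simp add: fourier_coeff_mult_monomial inner_function_def H2_def)
      finally show "fourier_coeff (Linf_cnj \<alpha> \<odot> monomial n) m = 0" .
    qed
    then have "cinner (Linf_cnj \<alpha> \<odot> monomial n) h = 0"
      using h by (simp add: orth_comp_def)
    then show ?thesis
      by (simp add: fourier_coeff_def cinner_Linf_mult cinner_commute[of h])
  qed
  then show ?thesis by (simp add: H2_def)
qed

text \<open>Multiplication by the conjugate is the adjoint of an operator that preserves \<open>H2\<close>.\<close>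

lemma inner_function_cnj_mult_orth_comp:
  assumes "inner_function \<alpha>" "f \<in> orth_comp H2"
  shows "Linf_cnj \<alpha> \<odot> f \<in> orth_comp H2"
  using assms inner_function_mult_H2 by (auto simp: orth_comp_def cinner_Linf_mult)

lemma inner_function_cancel [simp]: "inner_function \<alpha> \<Longrightarrow> Linf_cnj \<alpha> \<odot> \<alpha> \<odot> f = f"
  by (simp add: Linf_mult_assoc Linf_cnj_mult_self inner_function_def)

section \<open>The complement of a model space\<close>

lemma closed_csubspace_Int: "closed_csubspace X \<Longrightarrow> closed_csubspace Y \<Longrightarrow> closed_csubspace (X \<inter> Y)"
  by (auto simp: closed_csubspace_def)

lemma closed_csubspace_model_space: "closed_csubspace (model_space \<alpha>)"
  unfolding model_space_def
  by (intro closed_csubspace_Int closed_csubspace_H2 closed_csubspace_orth_comp)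

lemma closed_csubspace_model_space_perp: "closed_csubspace (model_space_perp \<alpha>)"
  unfolding model_space_perp_def by (rule closed_csubspace_orth_comp)

lemma model_space_perpI:
  assumes u: "u \<in> orth_comp H2" and h: "h \<in> H2"
  shows "u + \<alpha> \<odot> h \<in> model_space_perp \<alpha>"
proof -
  have "cinner u g = 0" "cinner g (\<alpha> \<odot> h) = 0" if "g \<in> model_space \<alpha>" for g
    using that u h by (auto simp: model_space_def orth_comp_def)
  then show ?thesis
    by (simp add: model_space_perp_def orth_comp_def cinner_add_left cinner_commute[of "\<alpha> \<odot> h"])
qed

text \<open>The complement of the model space splits as \<open>orth_comp H2\<close> plus \<open>\<alpha> \<odot> H2\<close>. Because \<open>\<alpha>\<close> is
  unimodular and multiplies \<open>H2\<close> into itself, \<open>f \<mapsto> \<alpha> \<odot> P_plus (Linf_cnj \<alpha> \<odot> f)\<close> is the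
  orthogonal projection onto the second summand.\<close>

lemma Q_proj_eq:
  assumes \<alpha>: "inner_function \<alpha>"
  shows "Q_proj \<alpha> f = P_minus f + \<alpha> \<odot> P_plus (Linf_cnj \<alpha> \<odot> f)"
proof -
  define p where "p = P_plus (Linf_cnj \<alpha> \<odot> f)"
  have "orth_proj (model_space \<alpha>) f = P_plus f - \<alpha> \<odot> p"
  proof (rule orth_proj_eqI[OF closed_csubspace_model_space])
    have "cinner (P_plus f - \<alpha> \<odot> p) (\<alpha> \<odot> h) = 0" if h: "h \<in> H2" for h
    proof -
      have "cinner (P_minus f) (\<alpha> \<odot> h) = 0" "cinner (P_minus (Linf_cnj \<alpha> \<odot> f)) h = 0"
        using h inner_function_mult_H2[OF \<alpha> h] P_minus_in_orth_comp by (auto simp: orth_comp_def)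
      then have "cinner (P_plus f) (\<alpha> \<odot> h) = cinner f (\<alpha> \<odot> h)"
          "cinner p h = cinner (Linf_cnj \<alpha> \<odot> f) h"
        by (simp_all add: p_def P_minus_def cinner_diff_left)
      then show ?thesis
        using \<alpha> by (simp add: cinner_diff_left cinner_Linf_mult)
    qed
    moreover have "P_plus f - \<alpha> \<odot> p \<in> H2"
      by (intro closed_csubspace_diff[OF closed_csubspace_H2] P_plus_in_H2
          inner_function_mult_H2[OF \<alpha>]) (simp add: p_def P_plus_in_H2)
    ultimately show "P_plus f - \<alpha> \<odot> p \<in> model_space \<alpha>"
      by (auto simp: model_space_def orth_comp_def)
    have "P_minus f + \<alpha> \<odot> p \<in> model_space_perp \<alpha>"
      by (intro model_space_perpI P_minus_in_orth_comp) (simp add: p_def P_plus_in_H2)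
    then show "f - (P_plus f - \<alpha> \<odot> p) \<in> orth_comp (model_space \<alpha>)"
      by (simp add: model_space_perp_def P_minus_def algebra_simps)
  qed
  then show ?thesis by (simp add: Q_proj_def P_minus_def p_def)
qed

lemma Q_proj_model_space_perp:
  assumes "f \<in> model_space_perp \<alpha>" shows "Q_proj \<alpha> f = f"
proof -
  have "orth_proj (model_space \<alpha>) f = 0"
    using assms closed_csubspace_model_space[of \<alpha>]
    by (intro orth_proj_eqI closed_csubspace_model_space)
      (auto simp: model_space_perp_def closed_csubspace_def)
  then show ?thesis by (simp add: Q_proj_def)
qed

section \<open>Bounded and invertible operators\<close>

text \<open>Every operator of the equivalence is given by a formula that makes sense on the whole ambient
  space. Boundedness is therefore established there, by rules that follow the syntax of the
  formula, and then restricted.\<close>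

lemma bounded_op_ident: "bounded_op UNIV UNIV (\<lambda>x. x)"
  by (auto simp: bounded_op_def intro!: exI[of _ 1])

lemma bounded_op_compose:
  assumes "bounded_op UNIV UNIV S" "bounded_op UNIV UNIV T"
  shows "bounded_op UNIV UNIV (\<lambda>x. S (T x))"
proof -
  obtain C D where C: "\<And>x. norm (S x) \<le> C * norm x" and D: "\<And>x. norm (T x) \<le> D * norm x"
    using assms by (auto simp: bounded_op_def)
  have "norm (S (T x)) \<le> (\<bar>C\<bar> * D) * norm x" for x
  proof -
    have "norm (S (T x)) \<le> \<bar>C\<bar> * norm (T x)"
      using C[of "T x"] mult_right_mono[OF abs_ge_self[of C] norm_ge_zero[of "T x"]] by linarith
    also have "\<dots> \<le> \<bar>C\<bar> * (D * norm x)" using D by (intro mult_left_mono) auto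
    finally show ?thesis by (simp add: mult.assoc)
  qed
  then show ?thesis using assms by (auto simp: bounded_op_def)
qed

lemma bounded_op_fst: "bounded_op UNIV UNIV fst"
  by (auto simp: bounded_op_def scaleC_prod_def intro!: exI[of _ 1] norm_fst_le)

lemma bounded_op_snd: "bounded_op UNIV UNIV snd"
  by (auto simp: bounded_op_def scaleC_prod_def intro!: exI[of _ 1] norm_snd_le)

lemma bounded_op_zero: "bounded_op UNIV UNIV (\<lambda>x. 0)"
  by (auto simp: bounded_op_def scaleC_diff_right[of _ 0 0, simplified] intro!: exI[of _ 1])

lemma bounded_op_Pair:
  assumes "bounded_op UNIV UNIV S" "bounded_op UNIV UNIV T"
  shows "bounded_op UNIV UNIV (\<lambda>x. (S x, T x))"
proof -
  obtain C D where C: "\<And>x. norm (S x) \<le> C * norm x" and D: "\<And>x. norm (T x) \<le> D * norm x"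
    using assms by (auto simp: bounded_op_def)
  have "norm (S x, T x) \<le> (C + D) * norm x" for x
    using norm_Pair_le[of "S x" "T x"] C[of x] D[of x] by (simp add: distrib_right)
  then show ?thesis using assms by (auto simp: bounded_op_def scaleC_prod_def)
qed

lemma bounded_op_plus: "bounded_op UNIV UNIV (\<lambda>x. fst x + snd x)"
proof -
  have "norm (fst x + snd x) \<le> 2 * norm x" for x :: "'a \<times> 'a"
    using norm_triangle_ineq[of "fst x" "snd x"] norm_fst_le[of "fst x" "snd x"]
      norm_snd_le[of "snd x" "fst x"] by simp
  then have "\<exists>C. \<forall>x :: 'a \<times> 'a. norm (fst x + snd x) \<le> C * norm x" by blast
  then show ?thesis by (simp add: bounded_op_def scaleC_prod_def scaleC_add_right algebra_simps)
qed

lemma bounded_op_add: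
  assumes "bounded_op UNIV UNIV S" "bounded_op UNIV UNIV T"
  shows "bounded_op UNIV UNIV (\<lambda>x. S x + T x)"
  using bounded_op_compose[OF bounded_op_plus bounded_op_Pair[OF assms]] by simp

lemma bounded_op_uminus:
  assumes "bounded_op UNIV UNIV T" shows "bounded_op UNIV UNIV (\<lambda>x. - T x)"
proof -
  have "c *\<^sub>C (- x) = - (c *\<^sub>C x)" for c and x :: 'b
    using scaleC_diff_right[of c 0 x] scaleC_diff_right[of c 0 0] by simp
  then show ?thesis using assms by (simp add: bounded_op_def)
qed

lemma bounded_op_diff:
  assumes "bounded_op UNIV UNIV S" "bounded_op UNIV UNIV T"
  shows "bounded_op UNIV UNIV (\<lambda>x. S x - T x)"
  using bounded_op_add[OF assms(1) bounded_op_uminus[OF assms(2)]] by simp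

lemma bounded_op_P_plus: "bounded_op UNIV UNIV P_plus"
  by (auto simp: bounded_op_def P_plus_add P_plus_scaleC norm_P_plus_le intro!: exI[of _ 1])

lemma bounded_op_P_minus: "bounded_op UNIV UNIV P_minus"
  unfolding P_minus_def[abs_def] by (intro bounded_op_diff bounded_op_ident bounded_op_P_plus)

lemma bounded_op_Linf_mult: "bounded_op UNIV UNIV ((\<odot>) a)"
  using Linf_mult_bounded[of a] by (auto simp: bounded_op_def Linf_mult_add Linf_mult_scaleC)

lemmas bounded_op_intros =
  bounded_op_ident bounded_op_zero bounded_op_Pair bounded_op_add bounded_op_diff bounded_op_uminus
  bounded_op_compose[OF bounded_op_fst] bounded_op_compose[OF bounded_op_snd]
  bounded_op_compose[OF bounded_op_P_plus] bounded_op_compose[OF bounded_op_P_minus]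
  bounded_op_compose[OF bounded_op_Linf_mult]

lemma bounded_op_restrict:
  "bounded_op UNIV UNIV T \<Longrightarrow> (\<And>x. x \<in> X \<Longrightarrow> T x \<in> Y) \<Longrightarrow> bounded_op X Y T"
  by (auto simp: bounded_op_def)

lemma invertible_opI:
  assumes "bounded_op UNIV UNIV T" "bounded_op UNIV UNIV R"
    and "\<And>x. x \<in> X \<Longrightarrow> T x \<in> Y" "\<And>y. y \<in> Y \<Longrightarrow> R y \<in> X"
    and "\<And>x. x \<in> X \<Longrightarrow> R (T x) = x" "\<And>y. y \<in> Y \<Longrightarrow> T (R y) = y"
  shows "invertible_op X Y T"
  using assms bounded_op_restrict[of T X Y] bounded_op_restrict[of R Y X]
  unfolding invertible_op_def by blast

section \<open>Equivalence after extension\<close>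

theorem theorem4p2:
  fixes \<phi> \<alpha> \<theta> :: Linf and A B :: "Linf^2^2"
  assumes "inner_function \<alpha>" and "inner_function \<theta>"
    and "A = vector [vector [\<phi> * \<theta>, -1], vector [\<phi> * \<theta> * Linf_cnj \<alpha>, 0]]"
    and "B = vector [vector [\<phi>, 0], vector [Linf_cnj \<alpha> * \<phi>, -1]]"
  shows "equivalent_after_extension TYPE(L2) TYPE(L2)
           (model_space_perp \<theta>) (model_space_perp \<alpha>) (dual_truncated_toeplitz \<phi> \<alpha>)
           UNIV UNIV (paired_op A B)"
proof -
  note \<alpha> = assms(1) and \<theta> = assms(2)
  define \<psi> where "\<psi> = Linf_cnj \<alpha> * \<phi>"
  \<comment> \<open>\<open>J\<close> maps \<open>L2\<close> isomorphically onto the complement of \<open>model_space \<theta>\<close>, with inverse \<open>K\<close>.\<close>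
  define J where "J u = P_minus u + \<theta> \<odot> P_plus u" for u
  define K where "K f = P_minus f + P_plus (Linf_cnj \<theta> \<odot> f)" for f
  \<comment> \<open>For \<open>f = J u\<close> the paired operator sends \<open>(u, v)\<close> to \<open>(a, b) = (\<phi> \<odot> f - P_plus v, \<psi> \<odot> f - P_minus v)\<close>,
      so that \<open>P_plus a + P_minus b = L f - v\<close>: the shear \<open>v = w + L f\<close> in \<open>F\<close> turns this into \<open>- w\<close>.\<close>
  define L where "L f = P_plus (\<phi> \<odot> f) + P_minus (\<psi> \<odot> f)" for f
  \<comment> \<open>The other halves of \<open>(a, b)\<close>, namely \<open>P_minus a\<close> and \<open>P_plus b\<close>, do not depend on \<open>v\<close>; they assemble
      to the truncated operator. The auxiliary spaces are \<open>L2\<close> and \<open>{0}\<close>.\<close>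
  define E :: "(L2 \<times> L2) \<times> L2 \<Rightarrow> L2 \<times> L2" where
    "E x = (P_minus (fst (fst x)) + \<alpha> \<odot> P_plus (snd (fst x)),
            - (P_plus (fst (fst x)) + P_minus (snd (fst x))))" for x
  define E' :: "L2 \<times> L2 \<Rightarrow> (L2 \<times> L2) \<times> L2" where
    "E' y = ((P_minus (fst y) - P_plus (snd y), P_plus (Linf_cnj \<alpha> \<odot> fst y) - P_minus (snd y)), 0)" for y
  define F :: "L2 \<times> L2 \<Rightarrow> (L2 \<times> L2) \<times> L2" where
    "F y = ((K (fst y), snd y + L (fst y)), 0)" for y
  define F' :: "(L2 \<times> L2) \<times> L2 \<Rightarrow> L2 \<times> L2" where
    "F' x = (J (fst (fst x)), snd (fst x) - L (J (fst (fst x))))" for x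
  have J_in: "J u \<in> model_space_perp \<theta>" for u
    unfolding J_def by (intro model_space_perpI P_minus_in_orth_comp P_plus_in_H2)
  have KJ: "K (J u) = u" for u
    using inner_function_mult_H2[OF \<theta> P_plus_in_H2[of u]]
      inner_function_cnj_mult_orth_comp[OF \<theta> P_minus_in_orth_comp[of u]] \<theta>
    by (simp add: J_def K_def Linf_mult_add P_plus_add P_minus_simps P_minus_in_orth_comp
        P_plus_add_P_minus P_minus_add_P_plus)
  have JK: "J (K f) = f" if "f \<in> model_space_perp \<theta>" for f
    using Q_proj_model_space_perp[OF that]
    by (simp add: Q_proj_eq[OF \<theta>] J_def K_def P_plus_add P_minus_simps P_plus_in_H2)
  have S: "paired_op A B (u, v) = (\<phi> \<odot> J u - P_plus v, \<psi> \<odot> J u - P_minus v)" for u v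
    by (simp add: paired_op_def matrix_op_def assms(3,4) vector_2 J_def \<psi>_def Linf_mult_add
        Linf_mult_assoc Linf_uminus_mult mult_ac)
  have T: "dual_truncated_toeplitz \<phi> \<alpha> f = P_minus (\<phi> \<odot> f) + \<alpha> \<odot> P_plus (\<psi> \<odot> f)" for f
    by (simp add: dual_truncated_toeplitz_def Q_proj_eq[OF \<alpha>] \<psi>_def Linf_mult_assoc)
  have inv_E: "invertible_op (UNIV \<times> {0}) (model_space_perp \<alpha> \<times> UNIV) E"
  proof (rule invertible_opI)
    show "bounded_op UNIV UNIV E" unfolding E_def by (intro bounded_op_intros)
    show "bounded_op UNIV UNIV E'" unfolding E'_def by (intro bounded_op_intros)
    show "E x \<in> model_space_perp \<alpha> \<times> UNIV" for x
      by (simp add: E_def model_space_perpI P_minus_in_orth_comp P_plus_in_H2)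
    show "E' y \<in> UNIV \<times> {0}" for y by (simp add: E'_def)
    show "E' (E x) = x" if "x \<in> UNIV \<times> {0}" for x
    proof -
      have "P_minus (\<alpha> \<odot> P_plus b) = 0" "P_plus (Linf_cnj \<alpha> \<odot> P_minus b) = 0" for b
        using inner_function_mult_H2[OF \<alpha> P_plus_in_H2[of b]]
          inner_function_cnj_mult_orth_comp[OF \<alpha> P_minus_in_orth_comp[of b]]
        by (simp_all add: P_minus_simps)
      with that \<alpha> show ?thesis
        by (auto simp: E_def E'_def P_plus_add P_plus_diff P_plus_uminus P_minus_simps
            Linf_mult_add P_plus_in_H2 P_plus_add_P_minus P_minus_add_P_plus)
    qed
    show "E (E' y) = y" if "y \<in> model_space_perp \<alpha> \<times> UNIV" for y
    proof -
      have "P_minus (fst y) + \<alpha> \<odot> P_plus (Linf_cnj \<alpha> \<odot> fst y) = fst y"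
        using that Q_proj_model_space_perp[of "fst y" \<alpha>] by (auto simp: Q_proj_eq[OF \<alpha>])
      then show ?thesis
        by (simp add: E_def E'_def P_plus_diff P_minus_simps P_plus_in_H2 prod_eq_iff
            P_plus_add_P_minus P_minus_add_P_plus)
    qed
  qed
  have inv_F: "invertible_op (model_space_perp \<theta> \<times> UNIV) (UNIV \<times> {0}) F"
  proof (rule invertible_opI)
    show "bounded_op UNIV UNIV F" unfolding F_def K_def L_def by (intro bounded_op_intros)
    show "bounded_op UNIV UNIV F'" unfolding F'_def J_def L_def by (intro bounded_op_intros)
  qed (auto simp: F_def F'_def J_in KJ JK)
  have eq: "map_prod (dual_truncated_toeplitz \<phi> \<alpha>) id y = E (map_prod (paired_op A B) id (F y))"
    if y_in: "y \<in> model_space_perp \<theta> \<times> UNIV" for y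
  proof -
    obtain f w where y: "y = (f, w)" "f \<in> model_space_perp \<theta>"
      using y_in by (cases y) auto
    have SF: "paired_op A B (K f, w + L f)
        = (\<phi> \<odot> f - P_plus (w + L f), \<psi> \<odot> f - P_minus (w + L f))"
      by (simp add: S JK[OF y(2)])
    have halves: "P_plus (L f) = P_plus (\<phi> \<odot> f)" "P_minus (L f) = P_minus (\<psi> \<odot> f)"
      by (simp_all add: L_def P_plus_add P_minus_simps P_plus_in_H2)
    have "E ((\<phi> \<odot> f - P_plus (w + L f), \<psi> \<odot> f - P_minus (w + L f)), 0)
        = (P_minus (\<phi> \<odot> f) + \<alpha> \<odot> P_plus (\<psi> \<odot> f), P_plus w + P_minus w)"
      by (simp add: E_def P_plus_add P_plus_diff P_minus_simps P_plus_in_H2 halves)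
    then show ?thesis
      by (simp add: y(1) F_def SF T P_plus_add_P_minus)
  qed
  have bounded_T: "bounded_op (model_space_perp \<theta>) (model_space_perp \<alpha>) (dual_truncated_toeplitz \<phi> \<alpha>)"
    unfolding T[abs_def]
  proof (rule bounded_op_restrict)
    show "bounded_op UNIV UNIV (\<lambda>f. P_minus (\<phi> \<odot> f) + \<alpha> \<odot> P_plus (\<psi> \<odot> f))"
      by (intro bounded_op_intros)
  qed (intro model_space_perpI P_minus_in_orth_comp P_plus_in_H2)
  have bounded_S: "bounded_op UNIV UNIV (paired_op A B)"
  proof -
    have "paired_op A B = (\<lambda>x. (\<phi> \<odot> J (fst x) - P_plus (snd x), \<psi> \<odot> J (fst x) - P_minus (snd x)))"
      by (simp add: fun_eq_iff S)
    then show ?thesis by (simp only: J_def) (intro bounded_op_intros)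
  qed
  have closed: "closed_csubspace (UNIV :: 'a::complex_banach set)" "closed_csubspace {0 :: L2}"
    by (auto simp: closed_csubspace_def scaleC_diff_right[of _ 0 0, simplified])
  have "\<forall>y \<in> model_space_perp \<theta> \<times> UNIV.
      map_prod (dual_truncated_toeplitz \<phi> \<alpha>) id y = E (map_prod (paired_op A B) id (F y))"
    using eq by blast
  with inv_E inv_F
  have "\<exists>(X\<^sub>0 :: L2 set) (Y\<^sub>0 :: L2 set) E F.
      closed_csubspace X\<^sub>0 \<and> closed_csubspace Y\<^sub>0 \<and>
      invertible_op (UNIV \<times> Y\<^sub>0) (model_space_perp \<alpha> \<times> X\<^sub>0) E \<and>
      invertible_op (model_space_perp \<theta> \<times> X\<^sub>0) (UNIV \<times> Y\<^sub>0) F \<and>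
      (\<forall>y \<in> model_space_perp \<theta> \<times> X\<^sub>0.
        map_prod (dual_truncated_toeplitz \<phi> \<alpha>) id y = E (map_prod (paired_op A B) id (F y)))"
    by (intro exI[of _ UNIV] exI[of _ "{0}"] exI[of _ E] exI[of _ F] conjI closed)
  then show ?thesis
    unfolding equivalent_after_extension_def
    by (intro conjI closed closed_csubspace_model_space_perp bounded_T bounded_S)
qed

end
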